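(* Let $\omega:\mathbb{R}^+\to\mathbb{R}^+$ be a function such that $\omega(t)/t$ is increasing and $\sum_{n\ge1}\frac{1}{\omega(n)}<\infty$. Let $\sum_{n=-\infty}^{\infty}c(n)e^{int}$ be a trigonometric series whose symmetric partial sums converge to $0$ for almost every $t\in\mathbb{T}$, and suppose that $c(n)=O\big(e^{-\omega(\log|n|)}\big)$ for $n<0$. Then $c(n)=0$ for all $n\in\mathbb{Z}$.
   Context: $\mathbb{T}=\mathbb{R}/2\pi\mathbb{Z}$; symmetric partial sums are $\sum_{|n|\le N}c(n)e^{int}$. *)

theory Defs
  imports "HOL-Analysis.Analysis"
begin

definition trig_partial_sum :: "(int \<Rightarrow> complex) \<Rightarrow> nat \<Rightarrow> real \<Rightarrow> complex" where
  "trig_partial_sum c N t = (\<Sum>n\<in>{- int N..int N}. c n * exp (\<i> * of_int n * of_real t))"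

end

theory Submission
  imports Defs "HOL-Complex_Analysis.Complex_Analysis" "HOL-Real_Asymp.Real_Asymp"
begin

text \<open>
  Let \<open>H\<^sub>m(z) = \<Sum>n\<ge>-4\<^sup>m. c n z\<^sup>n\<close>, considered on the circle of radius \<open>1 - 4\<^sup>-\<^sup>m\<close>. There
  \<open>log |H\<^sub>m| \<le> 2m + O(1)\<close>, since the coefficients are bounded, while replacing \<open>H\<^sub>m\<close> by \<open>H\<^sub>m\<^sub>+\<^sub>1\<close> changes it
  by at most \<open>exp (- \<omega>(m) / 2)\<close> up to a constant.

  Wherever the series converges boundedly to 0, Abel summation bounds \<open>H\<^sub>m\<close> in a sawtooth domain and a
  two-constants estimate against the harmonic measure of the exceptional set shows that \<open>H\<^sub>m\<close> lies below
  the barrier \<open>exp (- \<alpha>(m))\<close>, \<open>\<alpha>(m) = \<omega>(m - 1) / 8\<close>, on most of the circle for large \<open>m\<close>.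

  On the other hand, let \<open>w\<^sub>m\<close> be the positive part of \<open>\<alpha>(m) + log |H\<^sub>m|\<close> divided by its largest possible
  value \<open>\<alpha>(m) + 2m + O(1)\<close>. Subharmonicity gives \<open>mean w\<^sub>m \<le> (1 + 5 / \<alpha>(m)) mean w\<^sub>m\<^sub>+\<^sub>1\<close>: the worst case
  is that \<open>log |H|\<close> jumps from its upper bound down to the barrier. Because \<open>\<Sum> 1 / \<omega>(n)\<close> converges,
  the means can only grow by a bounded factor backwards in \<open>m\<close>; they tend to 0 by the first part, so they
  vanish. Hence \<open>|H\<^sub>m| \<le> exp (- \<alpha>(m))\<close> on the whole circle, and Cauchy's inequality kills every coefficient.
\<close>

section \<open>Circle means of subharmonic functions\<close>

text \<open>On the unit circle \<open>cnj z = 1 / z\<close>, so a real-linear functional, being the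
  real part of some \<open>a * z\<close>, becomes a Laurent polynomial. Sums and products keep this
  form over a common denominator.\<close>

lemma real_polynomial_function_unit_circle:
  fixes g :: "complex \<Rightarrow> real"
  assumes "real_polynomial_function g"
  shows "\<exists>p n. \<forall>z. norm z = 1 \<longrightarrow> complex_of_real (g z) = poly p z / z ^ n"
  using assms
proof (induction rule: real_polynomial_function.induct)
  case (linear f)
  define a where "a = Complex (f 1) (- f \<i>)"
  show ?case
  proof (intro exI allI impI)
    fix z :: complex assume z: "norm z = 1"
    then have z0: "z \<noteq> 0" by auto
    interpret f: bounded_linear f by fact
    have "f z = f (Re z *\<^sub>R 1 + Im z *\<^sub>R \<i>)"
      by (rule arg_cong[where f = f]) (simp add: complex_eq_iff)
    also have "\<dots> = Re z * f 1 + Im z * f \<i>"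
      by (simp add: f.add f.scaleR)
    finally have "f z = Re (a * z)" by (simp add: a_def)
    then have "complex_of_real (f z) = (a * z + cnj a * cnj z) / 2"
      by (metis complex_cnj_mult complex_add_cnj mult_2 nonzero_mult_div_cancel_left of_real_mult of_real_numeral zero_neq_numeral)
    also have "cnj z = 1 / z"
      using z z0 by (metis complex_div_cnj complex_cnj_one div_by_1 mult_1 of_real_1 power_one)
    finally show "complex_of_real (f z) = poly [:cnj a / 2, 0, a / 2:] z / z ^ 1"
      using z0 by (simp add: field_simps)
  qed
next
  case (const c)
  show ?case by (intro exI[of _ "[:of_real c:]"] exI[of _ 0]) simp
next
  case (add f g)
  then obtain p n q m where
    "\<And>z. norm z = 1 \<Longrightarrow> complex_of_real (f z) = poly p z / z ^ n"
    "\<And>z. norm z = 1 \<Longrightarrow> complex_of_real (g z) = poly q z / z ^ m" by blast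
  then show ?case
    by (intro exI[of _ "p * monom 1 m + q * monom 1 n"] exI[of _ "n + m"])
      (auto simp: poly_monom power_add add_divide_distrib)
next
  case (mult f g)
  then obtain p n q m where
    "\<And>z. norm z = 1 \<Longrightarrow> complex_of_real (f z) = poly p z / z ^ n"
    "\<And>z. norm z = 1 \<Longrightarrow> complex_of_real (g z) = poly q z / z ^ m" by blast
  then show ?case
    by (intro exI[of _ "p * q"] exI[of _ "n + m"]) (auto simp: power_add)
qed

text \<open>Conjugating \<open>a / z ^ k\<close> on the circle turns it into
  \<open>cnj a * z ^ k\<close> without changing the real part. This removes the pole, so the
  boundary values extend harmonically to the disc.\<close>

lemma Re_Laurent_polynomial_unit_circle:
  "\<exists>q. q holomorphic_on UNIV \<and> (\<forall>z. norm z = 1 \<longrightarrow> Re (poly p z / z ^ n) = Re (q z))"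
proof -
  define q where "q = (\<lambda>z. \<Sum>k\<le>degree p. if n \<le> k then coeff p k * z ^ (k - n)
                                          else cnj (coeff p k) * z ^ (n - k))"
  have "q holomorphic_on UNIV"
    unfolding q_def
  proof (intro holomorphic_on_sum)
    fix k
    show "(\<lambda>z. if n \<le> k then coeff p k * z ^ (k - n) else cnj (coeff p k) * z ^ (n - k)) holomorphic_on UNIV"
      by (cases "n \<le> k") (auto intro!: holomorphic_intros)
  qed
  moreover have "Re (poly p z / z ^ n) = Re (q z)" if z: "norm z = 1" for z
  proof -
    have z0: "z \<noteq> 0" using z by auto
    have cz: "cnj z = 1 / z"
      using z z0 by (metis complex_div_cnj complex_cnj_one div_by_1 mult_1 of_real_1 power_one)
    have "Re (poly p z / z ^ n) = (\<Sum>k\<le>degree p. Re (coeff p k * z ^ k / z ^ n))"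
      by (simp add: poly_altdef sum_divide_distrib)
    also have "\<dots> = Re (q z)"
      unfolding q_def Re_sum
    proof (rule sum.cong[OF refl])
      fix k
      show "Re (coeff p k * z ^ k / z ^ n) =
        Re (if n \<le> k then coeff p k * z ^ (k - n) else cnj (coeff p k) * z ^ (n - k))"
      proof (cases "n \<le> k")
        case True
        then show ?thesis using z0 by (simp add: power_diff)
      next
        case False
        then have "coeff p k * z ^ k / z ^ n = coeff p k * (1 / z) ^ (n - k)"
          using z0 by (simp add: power_diff power_divide)
        also have "\<dots> = cnj (cnj (coeff p k) * z ^ (n - k))"
          using cz by simp
        finally show ?thesis using False by (simp only: cnj.simps if_False)
      qed
    qed
    finally show ?thesis .
  qed
  ultimately show ?thesis by blast
qed

text \<open>Serves in place of solving the Dirichlet problem: Stone-Weierstrass gives a real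
  polynomial near \<open>\<phi>\<close>, which the two preceding lemmas turn into the real part of
  an entire function.\<close>

lemma continuous_on_circle_approx_Re_entire:
  fixes \<phi> :: "complex \<Rightarrow> real"
  assumes "continuous_on (sphere 0 R) \<phi>" "R > 0" "e > 0"
  obtains p where "p holomorphic_on UNIV" "\<And>z. norm z = R \<Longrightarrow> \<bar>\<phi> z - Re (p z)\<bar> < e"
proof -
  have "continuous_on (sphere 0 1) (\<lambda>z. \<phi> (of_real R * z))"
    by (rule continuous_on_compose2[OF assms(1)])
      (use assms in \<open>auto intro!: continuous_intros simp: norm_mult\<close>)
  then obtain g where g: "real_polynomial_function g"
    "\<And>z. z \<in> sphere 0 1 \<Longrightarrow> \<bar>\<phi> (of_real R * z) - g z\<bar> < e"
    using Stone_Weierstrass_real_polynomial_function[OF compact_sphere] \<open>e > 0\<close> by blast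
  obtain P n where P: "\<And>z. norm z = 1 \<Longrightarrow> complex_of_real (g z) = poly P z / z ^ n"
    using real_polynomial_function_unit_circle[OF g(1)] by blast
  obtain q where q: "q holomorphic_on UNIV"
    "\<And>z. norm z = 1 \<Longrightarrow> Re (poly P z / z ^ n) = Re (q z)"
    using Re_Laurent_polynomial_unit_circle by blast
  show thesis
  proof
    show "(\<lambda>z. q (z / of_real R)) holomorphic_on UNIV"
      by (rule holomorphic_on_compose_gen[of "\<lambda>z. z / of_real R" UNIV q UNIV, unfolded o_def])
        (use q(1) assms in \<open>auto intro!: holomorphic_intros\<close>)
    fix z :: complex assume z: "norm z = R"
    then have "norm (z / of_real R) = 1" using assms by (simp add: norm_divide)
    then show "\<bar>\<phi> z - Re (q (z / of_real R))\<bar> < e"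
      using g(2)[of "z / of_real R"] P[of "z / of_real R"] q(2)[of "z / of_real R"] assms
      by (metis Re_complex_of_real dist_0_norm less_numeral_extra(3) mem_sphere nonzero_mult_div_cancel_left of_real_eq_0_iff times_divide_eq_right)
  qed
qed

section \<open>Mean values and harmonic majorants\<close>

lemma has_integral_circle_mean:
  assumes "f holomorphic_on cball 0 r" "0 < r"
  shows "((\<lambda>t. f (of_real r * cis t)) has_integral 2 * of_real pi * f 0) {0..2*pi}"
proof -
  have "((\<lambda>u. f u / (u - 0)) has_contour_integral (2 * of_real pi * \<i> * f 0)) (circlepath 0 r)"
    using assms by (intro Cauchy_integral_circlepath_simple) auto
  then have "((\<lambda>t. f (0 + of_real r * cis t) / (0 + of_real r * cis t - 0) * of_real r * \<i> * cis t)
      has_integral (2 * of_real pi * \<i> * f 0)) {0..2*pi}"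
    unfolding circlepath_def by (subst (asm) has_contour_integral_part_circlepath_iff) auto
  then have "((\<lambda>t. \<i> * f (of_real r * cis t)) has_integral (2 * of_real pi * \<i> * f 0)) {0..2*pi}"
    by (rule has_integral_eq[rotated]) (use assms in \<open>auto simp: field_simps\<close>)
  from has_integral_mult_right[OF this, of "-\<i>"] show ?thesis
    by (simp add: algebra_simps)
qed

lemma integral_circle_mean_Re:
  assumes "f holomorphic_on cball 0 r" "0 < r"
  shows "integral {0..2*pi} (\<lambda>t. Re (f (of_real r * cis t))) = 2 * pi * Re (f 0)"
  using has_integral_linear[OF has_integral_circle_mean[OF assms] bounded_linear_Re]
  by (auto simp: o_def intro!: integral_unique)

lemma continuous_on_circle_path:
  fixes f :: "complex \<Rightarrow> 'a::topological_space"
  assumes "continuous_on (cball 0 R) f" "0 \<le> r" "r \<le> R"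
  shows "continuous_on T (\<lambda>t. f (of_real r * cis t))"
  by (rule continuous_on_compose2[OF assms(1)])
    (use assms in \<open>auto intro!: continuous_intros simp: norm_mult\<close>)

text \<open>A harmonic majorant argument for the subharmonic function \<open>Y\<close>: dominate \<open>Y\<close> on the outer circle
  by the real part of an entire function \<open>p\<close>, so that the maximum modulus principle for \<open>f e\<^sup>-\<^sup>p\<close>
  carries the domination inside.\<close>
lemma circle_mean_log_plus_mono:
  fixes f :: "complex \<Rightarrow> complex" and Y :: "complex \<Rightarrow> real"
  assumes f: "f holomorphic_on \<Omega>" and \<Omega>: "open \<Omega>"
    and Y: "continuous_on (cball 0 R) Y" "\<And>z. z \<in> cball 0 R \<Longrightarrow> 0 \<le> Y z"
    and eq: "\<And>z. z \<in> cball 0 R \<Longrightarrow> z \<in> \<Omega> \<Longrightarrow> Y z = ln (max 1 (norm (f z)))"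
    and zero: "\<And>z. z \<in> cball 0 R \<Longrightarrow> z \<notin> \<Omega> \<Longrightarrow> Y z = 0"
    and r: "0 < r" "r \<le> R"
  shows "integral {0..2*pi} (\<lambda>t. Y (of_real r * cis t)) \<le> integral {0..2*pi} (\<lambda>t. Y (of_real R * cis t))"
proof (cases "r = R")
  case False
  with r have rR: "0 < r" "r < R" "0 < R" by auto
  have intY: "(\<lambda>t. Y (of_real s * cis t)) integrable_on {0..2*pi}" if "0 \<le> s" "s \<le> R" for s
    by (intro integrable_continuous_real continuous_on_circle_path[OF Y(1)] that)
  show ?thesis
  proof (rule field_le_epsilon)
    fix e :: real assume "e > 0"
    \<comment> \<open>On the outer circle the majorant, approximating \<open>Y + d\<close>, exceeds
      \<open>Y\<close> by at most \<open>2 * d\<close>; integrated over length \<open>2 * pi\<close>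
      this costs \<open>e\<close>.\<close>
    define d where "d = e / (4 * pi)"
    have d: "d > 0" using \<open>e > 0\<close> by (simp add: d_def)
    have "continuous_on (sphere 0 R) (\<lambda>z. Y z + d)"
      by (intro continuous_intros continuous_on_subset[OF Y(1)]) auto
    then obtain p where p: "p holomorphic_on UNIV" "\<And>z. norm z = R \<Longrightarrow> \<bar>(Y z + d) - Re (p z)\<bar> < d"
      using continuous_on_circle_approx_Re_entire[of R "\<lambda>z. Y z + d" d] rR d by blast
    have pc: "continuous_on A p" for A
      using p(1) holomorphic_on_imp_continuous_on continuous_on_subset by blast
    have ph: "p holomorphic_on A" for A
      using p(1) holomorphic_on_subset by blast
    have p_bd: "Y z \<le> Re (p z)" "Re (p z) \<le> Y z + 2 * d" if "norm z = R" for z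
      using p(2)[OF that] by linarith+
    have p_pos: "0 \<le> Re (p z)" if "norm z < R" for z
    proof -
      have "norm (exp (- p z)) \<le> 1"
      proof (rule maximum_modulus_frontier[of "\<lambda>z. exp (- p z)" "ball 0 R"])
        show "(\<lambda>z. exp (- p z)) holomorphic_on interior (ball 0 R)"
          by (intro holomorphic_intros ph)
        show "continuous_on (closure (ball 0 R)) (\<lambda>z. exp (- p z))"
          by (intro continuous_intros pc)
        fix z :: complex assume "z \<in> frontier (ball 0 R)"
        then have "norm z = R" using rR by (simp add: frontier_def)
        then show "norm (exp (- p z)) \<le> 1"
          using p_bd(1)[of z] Y(2)[of z] by simp
      qed (use that in auto)
      then show ?thesis by simp
    qed
    have maj: "Y z \<le> Re (p z)" if z: "norm z < R" for z
    proof (rule field_le_epsilon)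
      fix \<eta> :: real assume \<eta>: "\<eta> > 0"
      \<comment> \<open>The positive level \<open>\<eta>\<close> keeps the closure of
        \<open>D\<close> inside \<open>\<Omega>\<close>, where
        \<open>norm (f w) = exp (Y w)\<close>. A frontier point either lies on the outer circle,
        where \<open>Y \<le> Re p\<close>, or has \<open>Y w \<le> \<eta>\<close> and
        \<open>Re (p w) \<ge> 0\<close>.\<close>
      define D where "D = {w \<in> ball 0 R. \<eta> < Y w}"
      have "D = ball 0 R \<inter> Y -` {\<eta><..}" by (auto simp: D_def)
      then have "open D"
        using continuous_open_preimage[OF continuous_on_subset[OF Y(1) ball_subset_cball] open_ball] by simp
      have clD: "closure D \<subseteq> {w \<in> cball 0 R. \<eta> \<le> Y w}"
      proof (rule closure_minimal)
        have "{w \<in> cball 0 R. \<eta> \<le> Y w} = cball 0 R \<inter> Y -` {\<eta>..}" by auto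
        then show "closed {w \<in> cball 0 R. \<eta> \<le> Y w}"
          using continuous_closed_preimage[OF Y(1) closed_cball, of "{\<eta>..}"] by simp
      qed (auto simp: D_def)
      then have clD\<Omega>: "closure D \<subseteq> \<Omega>"
        using zero \<eta> by force
      have normf: "norm (f w) = exp (Y w)" if "w \<in> closure D" for w
      proof -
        have w: "w \<in> cball 0 R" "w \<in> \<Omega>" "\<eta> \<le> Y w" using that clD clD\<Omega> by auto
        from eq[OF w(1,2)] w(3) \<eta> have "ln (max 1 (norm (f w))) > 0" by linarith
        then have "norm (f w) > 1" by (cases "norm (f w) \<le> 1") auto
        then have "max 1 (norm (f w)) = norm (f w)" "0 < norm (f w)" by linarith+
        then show ?thesis using eq[OF w(1,2)] exp_ln by metis
      qed
      show "Y z \<le> Re (p z) + \<eta>"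
      proof (cases "z \<in> D")
        case False
        with z have "Y z \<le> \<eta>" by (simp add: D_def)
        with p_pos[OF z] show ?thesis by simp
      next
        case True
        have "norm (f z * exp (- p z)) \<le> exp \<eta>"
        proof (rule maximum_modulus_frontier[of "\<lambda>z. f z * exp (- p z)" D])
          show "(\<lambda>z. f z * exp (- p z)) holomorphic_on interior D"
            using clD\<Omega> closure_subset[of D] interior_subset[of D]
            by (intro holomorphic_intros ph holomorphic_on_subset[OF f]) auto
          show "continuous_on (closure D) (\<lambda>z. f z * exp (- p z))"
            using f clD\<Omega> by (intro continuous_intros pc)
               (meson continuous_on_subset holomorphic_on_imp_continuous_on)
          show "bounded D" unfolding D_def by (rule bounded_subset[OF bounded_ball[of 0 R]]) auto
          fix w assume w: "w \<in> frontier D"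
          then have wc: "w \<in> closure D" "w \<notin> D"
            using \<open>open D\<close> by (auto simp: frontier_def interior_open)
          have eqw: "norm (f w * exp (- p w)) = exp (Y w - Re (p w))"
            unfolding norm_mult norm_exp_eq_Re using normf[OF wc(1)] by (simp add: exp_minus exp_diff divide_inverse)
          show "norm (f w * exp (- p w)) \<le> exp \<eta>"
          proof (cases "norm w = R")
            case True
            then show ?thesis using p_bd(1)[OF True] \<eta> eqw by simp
          next
            case False
            then have "norm w < R" using wc clD by auto
            with wc(2) have "Y w \<le> \<eta>" by (simp add: D_def)
            then show ?thesis using p_pos[OF \<open>norm w < R\<close>] eqw by simp
          qed
        qed (use True in auto)
        moreover have "norm (f z * exp (- p z)) = exp (Y z - Re (p z))"
          unfolding norm_mult norm_exp_eq_Re using normf[of z] True closure_subset[of D]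
          by (auto simp: exp_minus exp_diff divide_inverse)
        ultimately show ?thesis by simp
      qed
    qed
    have intp: "(\<lambda>t. Re (p (of_real s * cis t))) integrable_on {0..2*pi}" if "0 \<le> s" "s \<le> R" for s
      by (intro integrable_continuous_real continuous_on_circle_path[of R "\<lambda>z. Re (p z)"] that continuous_intros pc)
    have "integral {0..2*pi} (\<lambda>t. Y (of_real r * cis t)) \<le> integral {0..2*pi} (\<lambda>t. Re (p (of_real r * cis t)))"
      using rR by (intro integral_le intY intp maj) (auto simp: norm_mult)
    also have "\<dots> = integral {0..2*pi} (\<lambda>t. Re (p (of_real R * cis t)))"
      using rR ph by (simp add: integral_circle_mean_Re)
    also have "\<dots> \<le> integral {0..2*pi} (\<lambda>t. Y (of_real R * cis t) + 2 * d)"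
      using rR p_bd(2) by (intro integral_le integrable_add intY intp) (auto simp: norm_mult)
    also have "\<dots> = integral {0..2*pi} (\<lambda>t. Y (of_real R * cis t)) + e"
      using rR by (subst Henstock_Kurzweil_Integration.integral_add) (auto intro!: intY simp: d_def)
    finally show "integral {0..2*pi} (\<lambda>t. Y (of_real r * cis t))
        \<le> integral {0..2*pi} (\<lambda>t. Y (of_real R * cis t)) + e" .
  qed
qed auto

section \<open>Harmonic measure and the two-constants estimate\<close>

text \<open>\<open>2 / (1 - w) - 1\<close> is the Herglotz kernel \<open>(1 + w) / (1 - w)\<close>,
  and its real part is the Poisson kernel. In this form its integral reduces to that of a geometric
  series.\<close>

lemma Re_herglotz_kernel:
  fixes w :: complex
  assumes "norm w < 1"
  shows "Re (2 / (1 - w) - 1) = (1 - (norm w)\<^sup>2) / (norm (1 - w))\<^sup>2"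
proof -
  have nz: "1 - w \<noteq> 0" using assms by auto
  have "2 / (1 - w) - 1 = (1 + w) / (1 - w)" using nz by (simp add: field_simps)
  also have "\<dots> = (1 + w) * cnj (1 - w) / of_real ((norm (1 - w))\<^sup>2)"
    by (subst complex_div_cnj) simp
  finally have "Re (2 / (1 - w) - 1) = Re ((1 + w) * cnj (1 - w)) / (norm (1 - w))\<^sup>2"
    by (simp only: Re_divide_of_real)
  also have "Re ((1 + w) * cnj (1 - w)) = 1 - (norm w)\<^sup>2"
    unfolding cmod_power2 by (simp add: algebra_simps power2_eq_square)
  finally show ?thesis .
qed

lemma norm_circle_diff_le:
  fixes r t \<theta> :: real
  assumes "0 \<le> r" "r \<le> 1"
  shows "norm (1 - of_real r * cis (\<theta> - t)) \<le> (1 - r) + \<bar>\<theta> - t\<bar>"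
proof -
  have "1 - of_real r * cis (\<theta> - t) = of_real (1 - r) - of_real r * (cis (\<theta> - t) - 1)"
    by (simp add: algebra_simps)
  also have "norm \<dots> \<le> norm (of_real (1 - r) :: complex) + norm (of_real r * (cis (\<theta> - t) - 1))"
    by (rule norm_triangle_ineq4)
  also have "norm (of_real (1 - r) :: complex) = 1 - r" using assms by (simp only: norm_of_real)
  also have "norm (of_real r * (cis (\<theta> - t) - 1)) \<le> 1 * \<bar>\<theta> - t\<bar>"
  proof -
    have "norm (cis (\<theta> - t) - 1) = norm (exp (\<i> * of_real (\<theta> - t)) - 1)"
      by (simp add: cis_conv_exp)
    also have "\<dots> = 2 * \<bar>sin ((\<theta> - t) / 2)\<bar>"
      using dist_exp_i_1[of "\<theta> - t"] by (simp add: mult.commute)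
    also have "\<dots> \<le> 2 * \<bar>(\<theta> - t) / 2\<bar>"
      using abs_sin_x_le_abs_x[of "(\<theta> - t) / 2"] by linarith
    finally show ?thesis using assms
      unfolding norm_mult by (intro mult_mono) auto
  qed
  finally show ?thesis by simp
qed

text \<open>The function \<open>Re S\<close> is \<open>8\<pi>\<close> times the harmonic measure of the complement of \<open>G\<close>. The arcs are
  intervals in \<open>[0,2\<pi>]\<close>, not arcs modulo \<open>2\<pi>\<close>; near an endpoint half of the arc still suffices.\<close>
lemma harmonic_measure_complement:
  fixes G :: "real set"
  assumes G: "G \<in> sets borel"
  obtains S where "S holomorphic_on ball 0 1"
    "\<And>z. norm z < 1 \<Longrightarrow> 0 \<le> Re (S z)"
    "\<And>r \<theta>. \<lbrakk>0 \<le> r; r < 1; \<theta> \<in> {0..2*pi}; \<And>t. t \<in> G \<Longrightarrow> 1 - r \<le> \<bar>\<theta> - t\<bar>\<rbrakk>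
       \<Longrightarrow> 1 \<le> Re (S (of_real r * cis \<theta>))"
    "\<And>r. 0 < r \<Longrightarrow> r < 1 \<Longrightarrow> integral {0..2*pi} (\<lambda>\<theta>. Re (S (of_real r * cis \<theta>)))
       = 8 * pi * measure lborel ({0..2*pi} - G)"
proof -
  define O' where "O' = {0..2*pi} - G"
  define M where "M = restrict_space lborel O'"
  have O'[measurable]: "O' \<in> sets borel" using G by (simp add: O'_def)
  have O'fin: "emeasure lborel O' < \<infinity>"
  proof -
    have "emeasure lborel O' \<le> emeasure lborel {0..2*pi}"
      by (rule emeasure_mono) (auto simp: O'_def)
    also have "\<dots> < \<infinity>" by simp
    finally show ?thesis .
  qed
  have spM: "space M = O'" by (simp add: M_def space_restrict_space)
  have emM: "emeasure M A = emeasure lborel A" if "A \<subseteq> O'" for A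
    unfolding M_def by (rule emeasure_restrict_space) (use that in auto)
  interpret finite_measure M
    by (rule finite_measureI) (use spM emM[of O'] O'fin in auto)
  have meas: "f \<in> borel_measurable M" if "continuous_on UNIV f" for f :: "real \<Rightarrow> complex"
    unfolding M_def by (rule measurable_restrict_space1) (use borel_measurable_continuous_onI[OF that] in simp)
  define \<mu> where "\<mu> = measure lborel O'"
  have muM: "measure M (space M) = \<mu>" unfolding \<mu>_def measure_def using spM emM[of O'] by simp
  define w where "w = (\<lambda>(z::complex) t. z * cis (- t))"
  have nw: "norm (w z t) = norm z" for z t by (simp add: w_def norm_mult)
  have w1: "1 - w z t \<noteq> 0" if "norm z < 1" for z t
    using nw[of z t] that by auto
  have contw: "continuous_on UNIV (\<lambda>t. w z t)" for z
    unfolding w_def by (intro continuous_intros)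
  have low: "1 - norm z \<le> norm (1 - w z t)" for z t
    using norm_triangle_ineq2[of 1 "w z t"] nw by simp
  have kbd: "norm (1 / (1 - w z t)) \<le> 1 / (1 - norm z)" if "norm z < 1" for z t
    using low[of z t] that unfolding norm_divide by (auto intro!: divide_left_mono mult_pos_pos)
  have kint: "integrable M (\<lambda>t. 1 / (1 - w z t))" if "norm z < 1" for z
  proof (rule integrable_const_bound)
    show "(\<lambda>t. 1 / (1 - w z t)) \<in> borel_measurable M"
      by (rule meas) (intro continuous_intros contw, use w1[OF that] in auto)
  qed (use kbd[OF that] in auto)
  \<comment> \<open>\<open>T\<close> is the Cauchy transform of Lebesgue measure on
    \<open>O'\<close>, and \<open>S\<close> is 4 times the integral of the Herglotz kernel. The
    factor 4 compensates the lower bound 1/4 obtained below at points far from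
    \<open>G\<close>.\<close>
  define T where "T = (\<lambda>z. LINT t|M. 1 / (1 - w z t))"
  define S where "S = (\<lambda>z. 8 * T z - 4 * of_real \<mu>)"
  \<comment> \<open>The geometric expansion of the kernel, integrated termwise by dominated
    convergence, makes \<open>T\<close> a power series and hence holomorphic.\<close>
  have "(\<lambda>n. (LINT t|M. cis (- t) ^ n) * (z - 0) ^ n) sums T z" if "z \<in> ball 0 1" for z
  proof -
    have z: "norm z < 1" using that by simp
    have pint: "integrable M (\<lambda>t. cis (- t) ^ n * z ^ n)" for n
    proof (rule integrable_const_bound)
      show "AE t in M. norm (cis (- t) ^ n * z ^ n) \<le> norm z ^ n" by (simp add: norm_mult norm_power)
    qed (intro meas continuous_intros)
    have "(\<lambda>N. LINT t|M. (\<Sum>n<N. cis (- t) ^ n * z ^ n)) \<longlonglongrightarrow> (LINT t|M. 1 / (1 - w z t))"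
    proof (rule integral_dominated_convergence)
      show "integrable M (\<lambda>t. 1 / (1 - norm z))" by simp
      show "(\<lambda>t. 1 / (1 - w z t)) \<in> borel_measurable M" using kint[OF z] by simp
      show "(\<lambda>t. \<Sum>n<N. cis (- t) ^ n * z ^ n) \<in> borel_measurable M" for N
        by (intro meas continuous_intros)
      have "(\<lambda>n. cis (- t) ^ n * z ^ n) sums (1 / (1 - w z t))" for t
        using geometric_sums[of "w z t"] z nw[of z t]
        by (simp add: w_def power_mult_distrib mult.commute)
      then show "AE t in M. (\<lambda>N. \<Sum>n<N. cis (- t) ^ n * z ^ n) \<longlonglongrightarrow> 1 / (1 - w z t)"
        by (simp add: sums_def)
      show "AE t in M. norm (\<Sum>n<N. cis (- t) ^ n * z ^ n) \<le> 1 / (1 - norm z)" for N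
      proof (rule AE_I2)
        fix t
        have "norm (\<Sum>n<N. cis (- t) ^ n * z ^ n) \<le> (\<Sum>n<N. norm z ^ n)"
          by (rule order.trans[OF norm_sum]) (simp add: norm_mult norm_power)
        also have "\<dots> \<le> (\<Sum>n. norm z ^ n)"
          using z by (intro sum_le_suminf) (auto intro: summable_geometric)
        also have "\<dots> = 1 / (1 - norm z)" using z by (simp add: suminf_geometric)
        finally show "norm (\<Sum>n<N. cis (- t) ^ n * z ^ n) \<le> 1 / (1 - norm z)" .
      qed
    qed
    moreover have "(LINT t|M. (\<Sum>n<N. cis (- t) ^ n * z ^ n)) = (\<Sum>n<N. (LINT t|M. cis (- t) ^ n) * z ^ n)" for N
      by (subst Bochner_Integration.integral_sum) (auto intro: pint)
    ultimately show ?thesis by (simp add: sums_def T_def)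
  qed
  then have "T holomorphic_on ball 0 1" by (rule power_series_holomorphic)
  then have holS: "S holomorphic_on ball 0 1"
    unfolding S_def by (intro holomorphic_intros)
  have ReS: "Re (S z) = 4 * (LINT t|M. (1 - (norm z)\<^sup>2) / (norm (1 - w z t))\<^sup>2)"
    and Sint: "integrable M (\<lambda>t. (1 - (norm z)\<^sup>2) / (norm (1 - w z t))\<^sup>2)" if z: "norm z < 1" for z
  proof -
    have k: "integrable M (\<lambda>t. 2 * (1 / (1 - w z t)) - 1)"
      using kint[OF z] by (intro Bochner_Integration.integrable_diff integrable_mult_right) auto
    have eq: "Re (2 * (1 / (1 - w z t)) - 1) = (1 - (norm z)\<^sup>2) / (norm (1 - w z t))\<^sup>2" for t
      using Re_herglotz_kernel[of "w z t"] nw[of z t] z by simp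
    show "integrable M (\<lambda>t. (1 - (norm z)\<^sup>2) / (norm (1 - w z t))\<^sup>2)"
      using integrable_Re[OF k] by (simp only: eq)
    have "S z = 4 * (LINT t|M. 2 * (1 / (1 - w z t)) - 1)"
    proof -
      have "(LINT t|M. 2 * (1 / (1 - w z t)) - 1) = (LINT t|M. 2 * (1 / (1 - w z t))) - (LINT t|M. 1)"
        by (rule Bochner_Integration.integral_diff) (intro integrable_mult_right kint[OF z], simp)
      also have "(LINT t|M. 2 * (1 / (1 - w z t))) = 2 * T z"
        unfolding T_def by (rule integral_mult_right_zero)
      also have "(LINT t|M. (1::complex)) = of_real \<mu>" using muM by (simp add: scaleR_conv_of_real)
      finally have e: "(LINT t|M. 2 * (1 / (1 - w z t)) - 1) = 2 * T z - of_real \<mu>" .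
      show ?thesis unfolding e S_def by (simp add: algebra_simps)
    qed
    then have "Re (S z) = 4 * Re (LINT t|M. 2 * (1 / (1 - w z t)) - 1)" by simp
    also have "Re (LINT t|M. 2 * (1 / (1 - w z t)) - 1) = (LINT t|M. Re (2 * (1 / (1 - w z t)) - 1))"
      using integral_Re[OF k] by simp
    finally show "Re (S z) = 4 * (LINT t|M. (1 - (norm z)\<^sup>2) / (norm (1 - w z t))\<^sup>2)"
      by (simp only: eq)
  qed
  show thesis
  proof
    show "S holomorphic_on ball 0 1" by fact
    show "0 \<le> Re (S z)" if "norm z < 1" for z
    proof -
      have "(norm z)\<^sup>2 \<le> 1" using that by (simp add: power_le_one)
      then show ?thesis
        unfolding ReS[OF that] by (intro mult_nonneg_nonneg integral_nonneg_AE) auto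
    qed
  next
    fix r \<theta> :: real
    assume r: "0 \<le> r" "r < 1" and \<theta>: "\<theta> \<in> {0..2*pi}" and far: "\<And>t. t \<in> G \<Longrightarrow> 1 - r \<le> \<bar>\<theta> - t\<bar>"
    define z where "z = of_real r * cis \<theta>"
    have nz: "norm z = r" using r by (simp add: z_def norm_mult)
    define a where "a = (if \<theta> \<le> pi then \<theta> else \<theta> - (1 - r))"
    define J where "J = {a<..<a + (1 - r)}"
    have pi3: "3 \<le> pi" using pi_gt3 by simp
    have JO: "J \<subseteq> O'"
    proof
      fix t assume t: "t \<in> J"
      have "t \<notin> G" using far[of t] t by (auto simp: J_def a_def split: if_splits)
      moreover have "t \<in> {0..2*pi}" using t \<theta> r pi3 by (auto simp: J_def a_def split: if_splits)
      ultimately show "t \<in> O'" by (simp add: O'_def)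
    qed
    have Jm: "J \<in> sets M" using JO by (auto simp: M_def sets_restrict_space J_def)
    have lenJ: "measure M J = 1 - r"
      using emM[OF JO] r by (simp add: measure_def J_def)
    \<comment> \<open>On \<open>J\<close> the denominator is at most \<open>(2 * (1 - r))^2\<close>
      and the numerator at least \<open>1 - r\<close>, so the kernel is at least
      \<open>1 / (4 * (1 - r))\<close> on an interval of length \<open>1 - r\<close>.\<close>
    have "1 / 4 = (LINT t|M. indicator J t * (1 / (4 * (1 - r))))"
      using Jm lenJ r by (simp add: emeasure_eq_measure)
    also have "\<dots> \<le> (LINT t|M. (1 - (norm z)\<^sup>2) / (norm (1 - w z t))\<^sup>2)"
    proof (rule integral_mono)
      show "integrable M (\<lambda>t. indicator J t * (1 / (4 * (1 - r))))"
        using Jm by (intro integrable_mult_left integrable_real_indicator) (auto simp: emeasure_eq_measure)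
      show "integrable M (\<lambda>t. (1 - (norm z)\<^sup>2) / (norm (1 - w z t))\<^sup>2)"
        by (rule Sint) (use nz r in auto)
      fix t
      show "indicator J t * (1 / (4 * (1 - r))) \<le> (1 - (norm z)\<^sup>2) / (norm (1 - w z t))\<^sup>2"
      proof (cases "t \<in> J")
        case False
        then show ?thesis using r by (simp add: nz power_le_one)
      next
        case True
        have "w z t = of_real r * cis (\<theta> - t)" by (simp add: w_def z_def cis_mult)
        then have "norm (1 - w z t) \<le> (1 - r) + \<bar>\<theta> - t\<bar>"
          using norm_circle_diff_le[of r \<theta> t] r by simp
        also have "\<bar>\<theta> - t\<bar> \<le> 1 - r" using True by (auto simp: J_def a_def split: if_splits)
        finally have le: "norm (1 - w z t) \<le> 2 * (1 - r)" by simp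
        have pos: "0 < norm (1 - w z t)" using low[of z t] nz r by linarith
        have "(norm (1 - w z t))\<^sup>2 \<le> (2 * (1 - r))\<^sup>2" using le by (intro power_mono) auto
        then have "(1 - r) / (2 * (1 - r))\<^sup>2 \<le> (1 - r) / (norm (1 - w z t))\<^sup>2"
          using pos r by (intro divide_left_mono) (auto simp: zero_less_mult_iff)
        also have "\<dots> \<le> (1 - r\<^sup>2) / (norm (1 - w z t))\<^sup>2"
          using r by (intro divide_right_mono) (auto simp: power2_eq_square mult_left_le)
        also have "(1 - r) / (2 * (1 - r))\<^sup>2 = 1 / (4 * (1 - r))"
        proof -
          have "d / (2 * d)\<^sup>2 = 1 / (4 * d)" if "d > 0" for d :: real
            using that by (simp add: power2_eq_square)
          from this[of "1 - r"] r show ?thesis by simp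
        qed
        finally show ?thesis using True nz by simp
      qed
    qed
    finally show "1 \<le> Re (S (of_real r * cis \<theta>))"
      using ReS[of z] nz r by (simp add: z_def)
  next
    fix r :: real assume r: "0 < r" "r < 1"
    have "T 0 = of_real \<mu>" using muM by (simp add: T_def w_def scaleR_conv_of_real)
    then have "S 0 = 4 * of_real \<mu>" by (simp add: S_def)
    moreover have "S holomorphic_on cball 0 r"
      using r by (intro holomorphic_on_subset[OF holS]) auto
    ultimately show "integral {0..2*pi} (\<lambda>\<theta>. Re (S (of_real r * cis \<theta>))) = 8 * pi * measure lborel ({0..2*pi} - G)"
      using integral_circle_mean_Re[of S r] r by (simp add: \<mu>_def O'_def)
  qed
qed

text \<open>The positive part of the logarithm of \<open>h * exp (\<alpha> * (1 - S))\<close> on the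
  sawtooth region \<open>Re S < 1\<close>, extended by 0, has increasing circle means. It is bounded
  by \<open>\<alpha>\<close> and tends to 0 along every radius, so by dominated convergence these
  means vanish.\<close>

lemma two_constants_with_boundary_zero_set:
  fixes h S :: "complex \<Rightarrow> complex" and G :: "real set" and \<alpha> :: real
  assumes G: "closed G" and \<alpha>: "0 \<le> \<alpha>"
    and S: "S holomorphic_on ball 0 1" "\<And>z. norm z < 1 \<Longrightarrow> 0 \<le> Re (S z)"
      "\<And>r \<theta>. \<lbrakk>0 \<le> r; r < 1; \<theta> \<in> {0..2*pi}; \<And>t. t \<in> G \<Longrightarrow> 1 - r \<le> \<bar>\<theta> - t\<bar>\<rbrakk>
         \<Longrightarrow> 1 \<le> Re (S (of_real r * cis \<theta>))"
    and h: "h holomorphic_on ball 0 1" "\<And>z. norm z < 1 \<Longrightarrow> Re (S z) < 1 \<Longrightarrow> norm (h z) \<le> 1"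
    and lim: "\<And>t. t \<in> G \<Longrightarrow> \<exists>l. ((\<lambda>r. h (of_real r * cis t)) \<longlongrightarrow> l) (at_left 1) \<and> norm l \<le> exp (- \<alpha>)"
    and z: "z \<noteq> 0" "norm z < 1" "Re (S z) < 1"
  shows "norm (h z) \<le> exp (- \<alpha> * (1 - Re (S z)))"
proof -
  define f where "f = (\<lambda>z. h z * exp (of_real \<alpha> * (1 - S z)))"
  define L where "L = (\<lambda>z. ln (max 1 (norm (f z))))"
  \<comment> \<open>Where \<open>Re S < 1\<close>, the bound \<open>norm h \<le> 1\<close> makes the
    cutoff \<open>\<alpha> * (1 - Re S)\<close> inactive; where \<open>Re S \<ge> 1\<close> the
    cutoff is 0. The minimum thus glues \<open>L\<close> continuously to 0 without any control of
    \<open>h\<close> outside the region.\<close>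
  define Y where "Y = (\<lambda>z. min (L z) (max 0 (\<alpha> * (1 - Re (S z)))))"
  have fhol: "f holomorphic_on ball 0 1"
    unfolding f_def by (intro holomorphic_intros h S)
  have nf: "norm (f z) = norm (h z) * exp (\<alpha> * (1 - Re (S z)))" for z
    unfolding f_def norm_mult norm_exp_eq_Re by simp
  have contS: "continuous_on (ball 0 1) S" and contf: "continuous_on (ball 0 1) f"
    using S(1) fhol holomorphic_on_imp_continuous_on by blast+
  have contY: "continuous_on (ball 0 1) Y"
    unfolding Y_def L_def by (intro continuous_intros contf contS) (auto simp: max_def)
  have L0: "0 \<le> L z" for z by (simp add: L_def)
  have Y0: "0 \<le> Y z" for z using L0[of z] by (simp add: Y_def)
  have Ya: "Y z \<le> \<alpha>" if "norm z < 1" for z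
  proof -
    have "\<alpha> * (1 - Re (S z)) \<le> \<alpha> * 1" using S(2)[OF that] \<alpha> by (intro mult_left_mono) auto
    then show ?thesis using \<alpha> by (simp add: Y_def)
  qed
  define \<Omega> where "\<Omega> = {z \<in> ball 0 1. Re (S z) < 1}"
  have "\<Omega> = ball 0 1 \<inter> (\<lambda>z. Re (S z)) -` {..<1}" by (auto simp: \<Omega>_def)
  moreover have "continuous_on (ball 0 1) (\<lambda>z. Re (S z))" by (intro continuous_intros contS)
  ultimately have "open \<Omega>" using continuous_open_preimage[OF _ open_ball, of 0 1 "\<lambda>z. Re (S z)" "{..<1}"] by simp
  have YL: "Y z = L z" if "norm z < 1" "Re (S z) < 1" for z
  proof -
    have "0 \<le> \<alpha> * (1 - Re (S z))" using that \<alpha> by simp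
    moreover have "norm (f z) \<le> exp (\<alpha> * (1 - Re (S z)))"
      unfolding nf using h(2)[OF that] by simp
    ultimately have "max 1 (norm (f z)) \<le> exp (\<alpha> * (1 - Re (S z)))"
      by simp
    then have "L z \<le> ln (exp (\<alpha> * (1 - Re (S z))))"
      unfolding L_def by (subst ln_le_cancel_iff) auto
    then show ?thesis by (simp add: Y_def)
  qed
  have Yz: "Y z = 0" if "\<not> Re (S z) < 1" for z
  proof -
    have "\<alpha> * (1 - Re (S z)) \<le> 0" using that \<alpha> by (intro mult_nonneg_nonpos) auto
    then show ?thesis using L0[of z] by (simp add: Y_def)
  qed
  have mono: "integral {0..2*pi} (\<lambda>t. Y (of_real r * cis t)) \<le> integral {0..2*pi} (\<lambda>t. Y (of_real R * cis t))"
    if "0 < r" "r \<le> R" "R < 1" for r R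
  proof (rule circle_mean_log_plus_mono)
    show "f holomorphic_on \<Omega>" by (rule holomorphic_on_subset[OF fhol]) (auto simp: \<Omega>_def)
    show "open \<Omega>" by fact
    show "continuous_on (cball 0 R) Y" by (rule continuous_on_subset[OF contY]) (use that in auto)
  qed (use that Y0 YL Yz in \<open>auto simp: \<Omega>_def L_def\<close>)
  have intY: "(\<lambda>t. Y (of_real s * cis t)) integrable_on {0..2*pi}" if "0 \<le> s" "s < 1" for s
  proof (intro integrable_continuous_real continuous_on_circle_path[of s])
    show "continuous_on (cball 0 s) Y" by (rule continuous_on_subset[OF contY]) (use that in auto)
  qed (use that in auto)
  define R where "R = (\<lambda>n::nat. 1 - 1 / (real n + 2))"
  have R01: "0 < R n" "R n < 1" for n by (auto simp: R_def)
  have "(\<lambda>n. 1 / (real n + 2)) \<longlonglongrightarrow> 0" by real_asymp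
  then have "R \<longlonglongrightarrow> 1 - 0" unfolding R_def by (intro tendsto_intros)
  then have Rlim: "R \<longlonglongrightarrow> 1" by simp
  have RL: "filterlim R (at_left 1) sequentially"
    unfolding filterlim_at using Rlim R01 by (auto simp: less_imp_neq)
  \<comment> \<open>Over \<open>G\<close> the exponential factor is at most
    \<open>exp \<alpha>\<close>, which the radial limit of \<open>h\<close> compensates. Off the
    closed set \<open>G\<close> the end of the radius lies in \<open>Re S \<ge> 1\<close>, where
    \<open>Y\<close> is 0.\<close>
  have ptw: "(\<lambda>n. Y (of_real (R n) * cis t)) \<longlonglongrightarrow> 0" if t: "t \<in> {0..2*pi}" for t
  proof (cases "t \<in> G")
    case True
    then obtain l where l: "((\<lambda>r. h (of_real r * cis t)) \<longlongrightarrow> l) (at_left 1)" "norm l \<le> exp (- \<alpha>)"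
      using lim by blast
    have "(\<lambda>n. h (of_real (R n) * cis t)) \<longlonglongrightarrow> l"
      using filterlim_compose[OF l(1) RL] by simp
    then have "(\<lambda>n. ln (max 1 (norm (h (of_real (R n) * cis t)) * exp \<alpha>))) \<longlonglongrightarrow> ln (max 1 (norm l * exp \<alpha>))"
      by (intro tendsto_intros) (auto simp: max_def)
    moreover have "norm l * exp \<alpha> \<le> 1"
      using mult_right_mono[OF l(2), of "exp \<alpha>"] by (simp add: exp_minus)
    ultimately have up: "(\<lambda>n. ln (max 1 (norm (h (of_real (R n) * cis t)) * exp \<alpha>))) \<longlonglongrightarrow> 0"
      by (simp add: max_absorb1)
    show ?thesis
    proof (rule tendsto_sandwich[OF _ _ tendsto_const up])
      show "\<forall>\<^sub>F n in sequentially. 0 \<le> Y (of_real (R n) * cis t)" using Y0 by simp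
      show "\<forall>\<^sub>F n in sequentially. Y (of_real (R n) * cis t) \<le> ln (max 1 (norm (h (of_real (R n) * cis t)) * exp \<alpha>))"
      proof (rule always_eventually, rule allI)
        fix n
        let ?z = "of_real (R n) * cis t"
        have "norm ?z < 1" using R01[of n] by (simp add: norm_mult)
        then have "\<alpha> * (1 - Re (S ?z)) \<le> \<alpha> * 1" using S(2)[of ?z] \<alpha> by (intro mult_left_mono) auto
        then have "norm (f ?z) \<le> norm (h ?z) * exp \<alpha>"
          unfolding nf by (intro mult_left_mono) auto
        then have "L ?z \<le> ln (max 1 (norm (h ?z) * exp \<alpha>))"
          unfolding L_def by (subst ln_le_cancel_iff) auto
        then show "Y ?z \<le> ln (max 1 (norm (h ?z) * exp \<alpha>))" by (simp add: Y_def)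
      qed
    qed
  next
    case False
    then obtain e where e: "e > 0" "ball t e \<subseteq> - G"
      using G open_contains_ball by (metis ComplI open_Compl)
    have "\<forall>\<^sub>F n in sequentially. 1 - e < R n"
      using order_tendstoD(1)[OF Rlim, of "1 - e"] e by simp
    then have "\<forall>\<^sub>F n in sequentially. Y (of_real (R n) * cis t) = 0"
    proof eventually_elim
      case (elim n)
      have "1 - R n \<le> \<bar>t - s\<bar>" if "s \<in> G" for s
        using e that elim by (force simp: dist_real_def)
      then have "1 \<le> Re (S (of_real (R n) * cis t))"
        using S(3)[of "R n" t] R01[of n] t by simp
      then show ?case by (intro Yz) auto
    qed
    then show ?thesis by (simp add: tendsto_eventually)
  qed
  have lim0: "(\<lambda>n. integral {0..2*pi} (\<lambda>t. Y (of_real (R n) * cis t))) \<longlonglongrightarrow> integral {0..2*pi} (\<lambda>t. 0)"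
  proof (rule dominated_convergence(2))
    show "(\<lambda>t. Y (of_real (R n) * cis t)) integrable_on {0..2*pi}" for n
      using R01[of n] by (intro intY) auto
    show "(\<lambda>t. \<alpha>) integrable_on {0..2*pi}" by auto
    show "norm (Y (of_real (R n) * cis t)) \<le> \<alpha>" for n t
      using Y0 Ya[of "of_real (R n) * cis t"] R01[of n] by (simp add: norm_mult)
  qed (use ptw in auto)
  define r where "r = norm z"
  have r: "0 < r" "r < 1" using z by (auto simp: r_def)
  have "integral {0..2*pi} (\<lambda>t. Y (of_real r * cis t)) \<le> 0"
  proof (rule tendsto_lowerbound[OF lim0[unfolded integral_0]])
    have "\<forall>\<^sub>F n in sequentially. r < R n"
      using order_tendstoD(1)[OF Rlim] r by simp
    then show "\<forall>\<^sub>F n in sequentially. integral {0..2*pi} (\<lambda>t. Y (of_real r * cis t))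
        \<le> integral {0..2*pi} (\<lambda>t. Y (of_real (R n) * cis t))"
      by eventually_elim (use mono r R01 in auto)
  qed auto
  then have int0: "integral {0..2*pi} (\<lambda>t. Y (of_real r * cis t)) = 0"
    by (rule antisym) (use r Y0 in \<open>auto intro!: Henstock_Kurzweil_Integration.integral_nonneg intY\<close>)
  have contr: "continuous_on {0..2*pi} (\<lambda>t. Y (of_real r * cis t))"
    by (rule continuous_on_circle_path[of r]) (use r in \<open>auto intro: continuous_on_subset[OF contY]\<close>)
  have "Y (of_real r * cis t) = 0" if "t \<in> {0..2*pi}" for t
    using integral_eq_0_iff[OF contr] int0 Y0 that by auto
  moreover obtain t where "t \<in> {0..2*pi}" "z = of_real r * cis t"
  proof
    show "Arg2pi z \<in> {0..2*pi}" using Arg2pi[of z] by auto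
    show "z = of_real r * cis (Arg2pi z)" using Arg2pi_eq[of z] by (simp add: r_def cis_conv_exp)
  qed
  ultimately have "Y z = 0" by simp
  then have "ln (max 1 (norm (f z))) = 0" using YL[OF z(2,3)] by (simp add: L_def)
  then have "max 1 (norm (f z)) = 1" by (subst (asm) ln_eq_zero_iff) auto
  then have "norm (h z) * exp (\<alpha> * (1 - Re (S z))) \<le> 1" using nf[of z] by simp
  then have "norm (h z) \<le> 1 / exp (\<alpha> * (1 - Re (S z)))" by (subst pos_le_divide_eq) auto
  then show ?thesis by (simp add: exp_minus divide_inverse)
qed

section \<open>Abel summation and truncated series\<close>

text \<open>Let \<open>D n\<close> be the partial sum times \<open>\<zeta> ^ n\<close>. Then
  \<open>D (Suc n) - \<zeta> * D n\<close> is the next term of the power series, and summing this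
  identity replaces summation by parts.\<close>

lemma Abel_summation_sums:
  fixes a :: "nat \<Rightarrow> complex"
  assumes T: "\<And>n. norm (\<Sum>j\<le>n. a j) \<le> B" and \<zeta>: "norm \<zeta> < 1"
  shows "summable (\<lambda>n. (\<Sum>j\<le>n. a j) * \<zeta> ^ n)"
    and "(\<lambda>j. a j * \<zeta> ^ j) sums ((1 - \<zeta>) * (\<Sum>n. (\<Sum>j\<le>n. a j) * \<zeta> ^ n))"
proof -
  define D where "D = (\<lambda>n. (\<Sum>j\<le>n. a j) * \<zeta> ^ n)"
  have "summable D"
  proof (rule summable_comparison_test')
    show "summable (\<lambda>n. B * norm \<zeta> ^ n)" using \<zeta> by (intro summable_mult summable_geometric) simp
    show "norm (D n) \<le> B * norm \<zeta> ^ n" for n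
      unfolding D_def norm_mult norm_power by (intro mult_right_mono T) simp
  qed
  then show "summable (\<lambda>n. (\<Sum>j\<le>n. a j) * \<zeta> ^ n)" by (simp add: D_def)
  have s: "D sums suminf D" using \<open>summable D\<close> by (rule summable_sums)
  have "(\<lambda>n. D (Suc n) - \<zeta> * D n) sums (suminf D - D 0 - \<zeta> * suminf D)"
    using s by (intro sums_diff sums_mult) (simp_all add: sums_Suc_iff)
  moreover have "D (Suc n) - \<zeta> * D n = a (Suc n) * \<zeta> ^ Suc n" for n
    by (simp add: D_def algebra_simps)
  ultimately have "(\<lambda>n. a (Suc n) * \<zeta> ^ Suc n) sums (suminf D - D 0 - \<zeta> * suminf D)" by simp
  then have "(\<lambda>n. a n * \<zeta> ^ n) sums (suminf D - D 0 - \<zeta> * suminf D + a 0 * \<zeta> ^ 0)"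
    by (subst (asm) sums_Suc_iff)
  then show "(\<lambda>j. a j * \<zeta> ^ j) sums ((1 - \<zeta>) * (\<Sum>n. (\<Sum>j\<le>n. a j) * \<zeta> ^ n))"
    by (simp add: D_def algebra_simps)
qed

text \<open>The ratio \<open>norm (1 - \<zeta>) / (1 - norm \<zeta>)\<close> is bounded in Stolz
  angles at 1, so bounded partial sums at one boundary point control the series in a whole
  sector.\<close>

lemma Stolz_angle_bound:
  fixes a :: "nat \<Rightarrow> complex"
  assumes T: "\<And>n. norm (\<Sum>j\<le>n. a j) \<le> B" and \<zeta>: "norm \<zeta> < 1"
  shows "norm (\<Sum>j. a j * \<zeta> ^ j) \<le> B * norm (1 - \<zeta>) / (1 - norm \<zeta>)"
proof -
  have "(\<Sum>j. a j * \<zeta> ^ j) = (1 - \<zeta>) * (\<Sum>n. (\<Sum>j\<le>n. a j) * \<zeta> ^ n)"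
    using Abel_summation_sums(2)[OF assms] by (rule sums_unique[symmetric])
  moreover have "norm (\<Sum>n. (\<Sum>j\<le>n. a j) * \<zeta> ^ n) \<le> B / (1 - norm \<zeta>)"
  proof (rule order.trans[OF norm_suminf_le[of _ "\<lambda>n. B * norm \<zeta> ^ n"]])
    show "summable (\<lambda>n. B * norm \<zeta> ^ n)" using \<zeta> by (intro summable_mult summable_geometric) simp
    show "norm ((\<Sum>j\<le>n. a j) * \<zeta> ^ n) \<le> B * norm \<zeta> ^ n" for n
      unfolding norm_mult norm_power by (intro mult_right_mono T) simp
    show "(\<Sum>n. B * norm \<zeta> ^ n) \<le> B / (1 - norm \<zeta>)"
      using \<zeta> by (subst suminf_mult) (auto simp: suminf_geometric intro: summable_geometric)
  qed
  ultimately show ?thesis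
    by (simp add: norm_mult) (metis mult.commute mult_left_mono norm_ge_zero times_divide_eq_right)
qed

lemma Abel_radial_limit:
  fixes a :: "nat \<Rightarrow> complex"
  assumes "a sums l"
  shows "((\<lambda>r. \<Sum>j. a j * of_real r ^ j) \<longlongrightarrow> l) (at_left 1)"
proof -
  \<comment> \<open>Subtracting the sum from the zeroth term makes the partial sums tend to
    0.\<close>
  define b where "b = (\<lambda>j. a j - (if j = 0 then l else 0))"
  define T where "T = (\<lambda>n. \<Sum>j\<le>n. b j)"
  have "b sums (l - l)" unfolding b_def using assms sums_single[of 0 "\<lambda>_. l"] by (intro sums_diff) auto
  then have T0: "T \<longlonglongrightarrow> 0" by (simp add: sums_def_le T_def)
  then obtain B where B: "\<And>n. norm (T n) \<le> B"
    using convergent_imp_Bseq[OF convergentI] Bseq_def by metis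
  have key: "(\<Sum>j. a j * of_real r ^ j) - l = (1 - of_real r) * (\<Sum>n. T n * of_real r ^ n)" if "0 < r" "r < 1" for r
  proof -
    have n1: "norm (of_real r :: complex) < 1" using that by simp
    note A = Abel_summation_sums[OF B[unfolded T_def] n1]
    have "(\<lambda>j. b j * of_real r ^ j + (if j = 0 then l else 0)) sums
        ((1 - of_real r) * (\<Sum>n. T n * of_real r ^ n) + l)"
      using A(2) sums_single[of 0 "\<lambda>_. l"] unfolding T_def by (intro sums_add) auto
    moreover have "b j * of_real r ^ j + (if j = 0 then l else 0) = a j * of_real r ^ j" for j
      by (simp add: b_def)
    ultimately show "(\<Sum>j. a j * of_real r ^ j) - l = (1 - of_real r) * (\<Sum>n. T n * of_real r ^ n)"
      by (simp add: sums_iff)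
  qed
  have "((\<lambda>r. (\<Sum>j. a j * of_real r ^ j) - l) \<longlongrightarrow> 0) (at_left 1)"
  proof (rule tendstoI)
    fix e :: real assume "e > 0"
    then obtain N where N: "\<And>n. n \<ge> N \<Longrightarrow> norm (T n) < e / 2"
      using T0 unfolding LIMSEQ_iff by (metis diff_zero half_gt_zero)
    \<comment> \<open>\<open>Q\<close> bounds the contribution of the indices below
      \<open>N\<close>; its summand 1 ensures \<open>Q > 0\<close>. The indices from
      \<open>N\<close> on contribute at most \<open>e / 2\<close> after multiplication by
      \<open>1 - r\<close>.\<close>
    define Q where "Q = (\<Sum>n<N. norm (T n)) + 1"
    have Q: "Q > 0" unfolding Q_def by (intro add_nonneg_pos sum_nonneg) auto
    have "\<forall>\<^sub>F r in at_left (1::real). r \<in> {max 0 (1 - e / (2 * Q))<..<1}"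
      using \<open>e > 0\<close> Q by (intro eventually_at_leftI[of "max 0 (1 - e / (2 * Q))"]) auto
    then show "\<forall>\<^sub>F r in at_left 1. dist ((\<Sum>j. a j * of_real r ^ j) - l) 0 < e"
    proof eventually_elim
      case (elim r)
      then have r: "0 < r" "r < 1" "1 - e / (2 * Q) < r" by auto
      have sg: "summable (\<lambda>n. e / 2 * r ^ n)" using r by (intro summable_mult summable_geometric) auto
      have fin: "summable (\<lambda>n. if n < N then norm (T n) else 0)" by (rule summable_finite[of "{..<N}"]) auto
      have sn: "summable (\<lambda>n. (if n < N then norm (T n) else 0) + e / 2 * r ^ n)"
        by (intro summable_add sg fin)
      have "norm (\<Sum>n. T n * of_real r ^ n) \<le> (\<Sum>n. (if n < N then norm (T n) else 0) + e / 2 * r ^ n)"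
      proof (rule norm_suminf_le[OF _ sn])
        fix n
        show "norm (T n * of_real r ^ n) \<le> (if n < N then norm (T n) else 0) + e / 2 * r ^ n"
        proof (cases "n < N")
          case True
          have "norm (T n) * r ^ n \<le> norm (T n) * 1"
            using r by (intro mult_left_mono power_le_one) auto
          moreover have "0 \<le> e / 2 * r ^ n" using r \<open>e > 0\<close> by simp
          ultimately show ?thesis using True r by (simp add: norm_mult norm_power)
        next
          case False
          then show ?thesis using N[of n] r by (simp add: norm_mult norm_power mult_right_mono)
        qed
      qed
      also have "\<dots> = (\<Sum>n<N. norm (T n)) + (e / 2) / (1 - r)"
      proof -
        have "(\<Sum>n. if n < N then norm (T n) else 0) = (\<Sum>n<N. norm (T n))"
          by (subst suminf_finite[of "{..<N}"]) auto
        moreover have "(\<Sum>n. e / 2 * r ^ n) = (e / 2) / (1 - r)"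
          using r by (subst suminf_mult) (auto simp: suminf_geometric intro: summable_geometric)
        ultimately show ?thesis by (subst suminf_add[symmetric]) (use fin sg in auto)
      qed
      finally have b1: "norm (\<Sum>n. T n * of_real r ^ n) \<le> (\<Sum>n<N. norm (T n)) + (e / 2) / (1 - r)" .
      have n1r: "norm (1 - of_real r :: complex) = 1 - r"
        using r by (metis abs_of_pos diff_gt_0_iff_gt norm_of_real of_real_1 of_real_diff)
      have "norm ((\<Sum>j. a j * of_real r ^ j) - l) = (1 - r) * norm (\<Sum>n. T n * of_real r ^ n)"
        using key[OF r(1,2)] n1r by (simp add: norm_mult)
      also have "\<dots> \<le> (1 - r) * ((\<Sum>n<N. norm (T n)) + (e / 2) / (1 - r))"
        using r by (intro mult_left_mono b1) auto
      also have "\<dots> = (1 - r) * (\<Sum>n<N. norm (T n)) + e / 2" using r by (simp add: field_simps)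
      also have "(1 - r) * (\<Sum>n<N. norm (T n)) \<le> (1 - r) * Q"
        using r by (intro mult_left_mono) (auto simp: Q_def)
      also have "(1 - r) * Q < e / (2 * Q) * Q"
        using r Q by (intro mult_strict_right_mono) auto
      also have "e / (2 * Q) * Q = e / 2" using Q by simp
      finally show ?case by (simp add: dist_norm)
    qed
  qed
  then show ?thesis by (simp add: LIM_zero_iff)
qed

text \<open>This is \<open>z\<^sup>N\<close> times the Laurent series \<open>\<Sum>n\<ge>-N. c n z\<^sup>n\<close>; clearing the pole makes it holomorphic in the
  unit disc.\<close>
definition shifted_series :: "(int \<Rightarrow> complex) \<Rightarrow> nat \<Rightarrow> complex \<Rightarrow> complex" where
  "shifted_series c N z = (\<Sum>j. c (int j - int N) * z ^ j)"

section \<open>Truncation errors from the negative frequencies\<close>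

definition negative_tail :: "(int \<Rightarrow> complex) \<Rightarrow> nat \<Rightarrow> real" where
  "negative_tail c N = (\<Sum>k. norm (c (- int (k + N + 1))))"

lemma shifted_series_sums:
  assumes c: "\<And>n. norm (c n) \<le> C" and z: "norm z < 1"
  shows "(\<lambda>j. c (int j - int N) * z ^ j) sums shifted_series c N z"
    and "norm (shifted_series c N z) \<le> C / (1 - norm z)"
proof -
  have sg: "summable (\<lambda>j. C * norm z ^ j)" using z by (intro summable_mult summable_geometric) simp
  have le: "norm (c (int j - int N) * z ^ j) \<le> C * norm z ^ j" for j
    unfolding norm_mult norm_power by (intro mult_right_mono c) simp
  have "summable (\<lambda>j. c (int j - int N) * z ^ j)"
    by (rule summable_comparison_test'[OF sg le])
  then show "(\<lambda>j. c (int j - int N) * z ^ j) sums shifted_series c N z"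
    unfolding shifted_series_def by (rule summable_sums)
  have "norm (shifted_series c N z) \<le> (\<Sum>j. C * norm z ^ j)"
    unfolding shifted_series_def by (rule norm_suminf_le[OF le sg])
  also have "\<dots> = C / (1 - norm z)"
    using z by (subst suminf_mult) (auto simp: suminf_geometric intro: summable_geometric)
  finally show "norm (shifted_series c N z) \<le> C / (1 - norm z)" .
qed

lemma shifted_series_holomorphic:
  assumes "\<And>n. norm (c n) \<le> C"
  shows "shifted_series c N holomorphic_on ball 0 1"
proof (rule power_series_holomorphic)
  fix w :: complex assume "w \<in> ball 0 1"
  then show "(\<lambda>j. c (int j - int N) * (w - 0) ^ j) sums shifted_series c N w"
    using shifted_series_sums(1)[of c C w N] assms by simp
qed

lemma negative_sum_le_tail:
  assumes sm: "summable (\<lambda>k. norm (c (- int k)))" and A: "finite A" "A \<subseteq> {..<- int N}"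
  shows "(\<Sum>n\<in>A. norm (c n)) \<le> negative_tail c N"
proof -
  have sm': "summable (\<lambda>k. norm (c (- int (k + N + 1))))"
    using summable_ignore_initial_segment[OF sm, of "N + 1"] by (simp add: add.assoc)
  define g where "g = (\<lambda>n. nat (- n - int N - 1))"
  have "(\<Sum>n\<in>A. norm (c n)) = (\<Sum>k\<in>g ` A. norm (c (- int (k + N + 1))))"
  proof (subst sum.reindex)
    show "inj_on g A"
    proof (rule inj_onI)
      fix x y assume "x \<in> A" "y \<in> A" "g x = g y"
      moreover from this have "x < - int N" "y < - int N" using A by auto
      ultimately show "x = y" unfolding g_def by linarith
    qed
    show "(\<Sum>n\<in>A. norm (c n)) = sum ((\<lambda>k. norm (c (- int (k + N + 1)))) \<circ> g) A"
      unfolding o_def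
    proof (rule sum.cong[OF refl])
      fix n assume "n \<in> A"
      then have "- int (g n + N + 1) = n" using A by (force simp: g_def)
      then show "norm (c n) = norm (c (- int (g n + N + 1)))" by simp
    qed
  qed
  also have "\<dots> \<le> negative_tail c N"
    unfolding negative_tail_def using A by (intro sum_le_suminf sm') auto
  finally show ?thesis .
qed

text \<open>The factor \<open>z ^ (N' - N)\<close> aligns the powers, so all frequencies from
  \<open>-N\<close> on cancel. The finitely many others, from \<open>-N'\<close> to
  \<open>-N - 1\<close>, come with powers of modulus at most 1.\<close>

lemma shifted_series_diff_bound:
  assumes c: "\<And>n. norm (c n) \<le> C" and sm: "summable (\<lambda>k. norm (c (- int k)))"
    and N: "N \<le> N'" and z: "norm z < 1"
  shows "norm (shifted_series c N' z - z ^ (N' - N) * shifted_series c N z) \<le> negative_tail c N"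
proof -
  define d where "d = N' - N"
  have N': "N' = N + d" using N by (simp add: d_def)
  have s: "summable (\<lambda>j. c (int j - int N') * z ^ j)"
    using shifted_series_sums(1)[OF c z] by (rule sums_summable)
  have "shifted_series c N' z = (\<Sum>j. c (int (j + d) - int N') * z ^ (j + d)) + (\<Sum>j<d. c (int j - int N') * z ^ j)"
    unfolding shifted_series_def using s by (rule suminf_split_initial_segment)
  also have "(\<lambda>j. c (int (j + d) - int N') * z ^ (j + d)) = (\<lambda>j. z ^ d * (c (int j - int N) * z ^ j))"
    by (simp add: N' power_add fun_eq_iff)
  also have "(\<Sum>j. z ^ d * (c (int j - int N) * z ^ j)) = z ^ d * shifted_series c N z"
    unfolding shifted_series_def
    by (rule suminf_mult) (use shifted_series_sums(1)[OF c z] in \<open>rule sums_summable\<close>)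
  finally have "norm (shifted_series c N' z - z ^ (N' - N) * shifted_series c N z)
      = norm (\<Sum>j<d. c (int j - int N') * z ^ j)" by (simp add: d_def)
  also have "\<dots> \<le> (\<Sum>j<d. norm (c (int j - int N')))"
  proof (rule order.trans[OF norm_sum sum_mono])
    fix j
    have "norm (c (int j - int N')) * norm z ^ j \<le> norm (c (int j - int N')) * 1"
      using z by (intro mult_left_mono power_le_one) auto
    then show "norm (c (int j - int N') * z ^ j) \<le> norm (c (int j - int N'))"
      by (simp add: norm_mult norm_power)
  qed
  also have "\<dots> = (\<Sum>n\<in>(\<lambda>j. int j - int N') ` {..<d}. norm (c n))"
    by (subst sum.reindex) (auto simp: inj_on_def)
  also have "\<dots> \<le> negative_tail c N"
    by (rule negative_sum_le_tail[OF sm]) (auto simp: N')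
  finally show ?thesis .
qed

section \<open>Boundary behaviour at points of convergence\<close>

lemma shifted_partial_sum_eq:
  "(\<Sum>j\<le>J. c (int j - int N) * cis t ^ j) =
    cis (real N * t) * (\<Sum>n\<in>{- int N..int J - int N}. c n * exp (\<i> * of_int n * of_real t))"
proof -
  have "(\<Sum>n\<in>{- int N..int J - int N}. cis (real N * t) * (c n * exp (\<i> * of_int n * of_real t)))
     = (\<Sum>j\<le>J. c (int j - int N) * cis t ^ j)"
  proof (rule sum.reindex_bij_witness[of _ "\<lambda>j. int j - int N" "\<lambda>n. nat (n + int N)"])
    fix n assume n: "n \<in> {- int N..int J - int N}"
    then have "real (nat (n + int N)) = of_int n + real N" by simp
    then have "cis t ^ nat (n + int N) = cis ((of_int n + real N) * t)" by (simp only: Complex.DeMoivre)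
    also have "\<dots> = cis (real N * t) * exp (\<i> * of_int n * of_real t)"
      by (simp add: cis_conv_exp exp_add[symmetric] algebra_simps)
    finally show "c (int (nat (n + int N)) - int N) * cis t ^ nat (n + int N) =
        cis (real N * t) * (c n * exp (\<i> * of_int n * of_real t))"
      using n by simp
  qed auto
  then show ?thesis by (simp add: sum_distrib_left)
qed

lemma norm_exp_i_int_real [simp]: "norm (exp (\<i> * of_int n * of_real t :: complex)) = 1"
  by (simp add: norm_exp_eq_Re)

text \<open>The window from \<open>-N\<close> to \<open>J - N\<close> differs from a symmetric one,
  or from the empty one if \<open>J < N\<close>, only in negative frequencies, which are absolutely
  summable. The uniformity in \<open>N\<close> lets the cutoff vary with the radius later.\<close>

lemma shifted_partial_sum_bound:
  assumes sm: "summable (\<lambda>k. norm (c (- int k)))" and K: "\<And>L. norm (trig_partial_sum c L t) \<le> K"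
  shows "norm (\<Sum>j\<le>J. c (int j - int N) * cis t ^ j) \<le> K + negative_tail c 0"
proof -
  define u where "u = (\<lambda>n. c n * exp (\<i> * of_int n * of_real t))"
  have neg: "norm (sum u A) \<le> negative_tail c 0" if "finite A" "A \<subseteq> {..<0}" for A
  proof -
    have "norm (sum u A) \<le> (\<Sum>n\<in>A. norm (c n))"
      by (rule order.trans[OF norm_sum]) (simp add: u_def norm_mult)
    also have "\<dots> \<le> negative_tail c 0" using negative_sum_le_tail[OF sm, of A 0] that by simp
    finally show ?thesis .
  qed
  have K0: "0 \<le> K" using K[of 0] norm_ge_zero order.trans by blast
  have ps: "norm (sum u {- int l..int l}) \<le> K" for l
    using K[of l] by (simp add: trig_partial_sum_def u_def)
  have "norm (sum u {- int N..int J - int N}) \<le> K + negative_tail c 0"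
  proof (cases "J < N")
    case True
    then have "norm (sum u {- int N..int J - int N}) \<le> negative_tail c 0" by (intro neg) auto
    then show ?thesis using K0 by simp
  next
    case False
    define l where "l = J - N"
    have L: "int J - int N = int l" using False by (simp add: l_def)
    show ?thesis
    proof (cases "l < N")
      case True
      then have "{- int N..int l} = {- int N..<- int l} \<union> {- int l..int l}" by auto
      then have "sum u {- int N..int l} = sum u {- int N..<- int l} + sum u {- int l..int l}"
        by (simp only: sum.union_disjoint finite_atLeastLessThan_int finite_atLeastAtMost_int) (subst sum.union_disjoint, auto)
      moreover have "norm (sum u {- int N..<- int l}) \<le> negative_tail c 0" by (intro neg) auto
      ultimately show ?thesis unfolding L using ps[of l] norm_triangle_ineq order.trans
        by (smt (verit))
    next
      case False
      then have "{- int l..int l} = {- int l..<- int N} \<union> {- int N..int l}" by auto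
      then have "sum u {- int l..int l} = sum u {- int l..<- int N} + sum u {- int N..int l}"
        by (simp only:) (subst sum.union_disjoint, auto)
      then have "sum u {- int N..int l} = sum u {- int l..int l} - sum u {- int l..<- int N}" by simp
      moreover have "norm (sum u {- int l..<- int N}) \<le> negative_tail c 0" by (intro neg) auto
      ultimately show ?thesis unfolding L using ps[of l] norm_triangle_ineq4 order.trans
        by (smt (verit))
    qed
  qed
  then show ?thesis unfolding shifted_partial_sum_eq by (simp add: norm_mult u_def)
qed

text \<open>The symmetric sums tend to 0, so the series over the frequencies from \<open>-N\<close>
  on converges to minus the absolutely convergent sum of the omitted ones, up to a rotation.\<close>

lemma shifted_boundary_series_sums:
  assumes sm: "summable (\<lambda>k. norm (c (- int k)))" and lim: "(\<lambda>L. trig_partial_sum c L t) \<longlonglongrightarrow> 0"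
  obtains l where "(\<lambda>j. c (int j - int N) * cis t ^ j) sums l" "norm l \<le> negative_tail c N"
proof -
  define u where "u = (\<lambda>n. c n * exp (\<i> * of_int n * of_real t))"
  define v where "v = (\<lambda>k. u (- int (k + N + 1)))"
  have sm': "summable (\<lambda>k. norm (v k))"
    using summable_ignore_initial_segment[OF sm, of "N + 1"] by (simp add: add.assoc v_def u_def norm_mult)
  \<comment> \<open>Top index \<open>J + 2 * N\<close> means top frequency \<open>J + N\<close>, so
    the symmetric window contains the truncated one and exactly \<open>J\<close> frequencies below
    \<open>-N\<close> are removed.\<close>
  have "sum u {- int N..int (J + 2 * N) - int N} = trig_partial_sum c (J + N) t - (\<Sum>k<J. v k)" for J
  proof -
    have "{- int (J + N)..int (J + N)} = {- int (J + N)..<- int N} \<union> {- int N..int (J + N)}" by auto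
    then have "trig_partial_sum c (J + N) t = sum u {- int (J + N)..<- int N} + sum u {- int N..int (J + N)}"
      unfolding trig_partial_sum_def u_def[symmetric] by (simp only:) (subst sum.union_disjoint, auto)
    moreover have "sum u {- int (J + N)..<- int N} = (\<Sum>k<J. v k)"
      unfolding v_def
      by (rule sum.reindex_bij_witness[of _ "\<lambda>k. - int (k + N + 1)" "\<lambda>n. nat (- n - int N - 1)"]) auto
    ultimately show ?thesis by (simp add: algebra_simps)
  qed
  moreover have "(\<lambda>J. trig_partial_sum c (J + N) t - (\<Sum>k<J. v k)) \<longlonglongrightarrow> 0 - suminf v"
    by (intro tendsto_diff LIMSEQ_ignore_initial_segment lim summable_LIMSEQ summable_norm_cancel[OF sm'])
  ultimately have "(\<lambda>J. cis (real N * t) * sum u {- int N..int (J + 2 * N) - int N}) \<longlonglongrightarrow> cis (real N * t) * (- suminf v)"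
    by (intro tendsto_mult_left) simp
  then have "(\<lambda>J. (\<Sum>j\<le>J + 2 * N. c (int j - int N) * cis t ^ j)) \<longlonglongrightarrow> cis (real N * t) * (- suminf v)"
    unfolding shifted_partial_sum_eq u_def .
  then have "(\<lambda>J. (\<Sum>j\<le>J. c (int j - int N) * cis t ^ j)) \<longlonglongrightarrow> cis (real N * t) * (- suminf v)"
    by (rule LIMSEQ_offset)
  then have "(\<lambda>j. c (int j - int N) * cis t ^ j) sums (cis (real N * t) * (- suminf v))"
    by (simp add: sums_def_le)
  moreover have "norm (cis (real N * t) * (- suminf v)) \<le> negative_tail c N"
    using summable_norm[OF sm'] by (simp add: norm_mult negative_tail_def v_def u_def)
  ultimately show thesis using that by blast
qed

text \<open>Seen from the boundary point \<open>cis t\<close>, the point is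
  \<open>cis t * \<zeta>\<close> with \<open>norm (1 - \<zeta>) \<le> 2 * (1 - r)\<close>, that is,
  \<open>\<zeta>\<close> lies in a fixed Stolz angle. The bound does not depend on
  \<open>N\<close>.\<close>

lemma shifted_series_sawtooth_bound:
  assumes sm: "summable (\<lambda>k. norm (c (- int k)))" and K: "\<And>L. norm (trig_partial_sum c L t) \<le> K"
    and r: "0 \<le> r" "r < 1" "\<bar>\<theta> - t\<bar> \<le> 1 - r"
  shows "norm (shifted_series c N (of_real r * cis \<theta>)) \<le> 2 * (K + negative_tail c 0)"
proof -
  define \<zeta> where "\<zeta> = of_real r * cis (\<theta> - t)"
  have n\<zeta>: "norm \<zeta> = r" using r by (simp add: \<zeta>_def norm_mult)
  have "cis t * \<zeta> = of_real r * cis \<theta>" by (simp add: \<zeta>_def cis_mult)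
  then have "shifted_series c N (of_real r * cis \<theta>) = (\<Sum>j. c (int j - int N) * cis t ^ j * \<zeta> ^ j)"
    unfolding shifted_series_def by (metis (no_types, lifting) mult.assoc power_mult_distrib)
  then have "norm (shifted_series c N (of_real r * cis \<theta>))
      \<le> (K + negative_tail c 0) * norm (1 - \<zeta>) / (1 - norm \<zeta>)"
    using Stolz_angle_bound[of "\<lambda>j. c (int j - int N) * cis t ^ j" "K + negative_tail c 0" \<zeta>]
      shifted_partial_sum_bound[OF sm K] n\<zeta> r by simp
  also have "\<dots> \<le> (K + negative_tail c 0) * (2 * (1 - r)) / (1 - norm \<zeta>)"
  proof (intro divide_right_mono mult_left_mono)
    show "norm (1 - \<zeta>) \<le> 2 * (1 - r)"
      using norm_circle_diff_le[of r \<theta> t] r by (simp add: \<zeta>_def)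
    show "0 \<le> K + negative_tail c 0"
      using shifted_partial_sum_bound[OF sm K, of 0 0] norm_ge_zero order.trans by blast
  qed (use n\<zeta> r in auto)
  also have "\<dots> = 2 * (K + negative_tail c 0)" using n\<zeta> r by (simp add: divide_eq_eq) (simp add: algebra_simps)
  finally show ?thesis .
qed

lemma shifted_series_radial_limit:
  assumes sm: "summable (\<lambda>k. norm (c (- int k)))" and lim: "(\<lambda>L. trig_partial_sum c L t) \<longlonglongrightarrow> 0"
  shows "\<exists>l. ((\<lambda>r. shifted_series c N (of_real r * cis t)) \<longlongrightarrow> l) (at_left 1) \<and> norm l \<le> negative_tail c N"
proof -
  obtain l where l: "(\<lambda>j. c (int j - int N) * cis t ^ j) sums l" "norm l \<le> negative_tail c N"
    using shifted_boundary_series_sums[OF assms] .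
  have "shifted_series c N (of_real r * cis t) = (\<Sum>j. c (int j - int N) * cis t ^ j * of_real r ^ j)" for r
    unfolding shifted_series_def by (simp add: power_mult_distrib mult_ac)
  with Abel_radial_limit[OF l(1)] l(2) show ?thesis by auto
qed

text \<open>Convergent sequences are bounded, so the closed sets where all partial sums are at most
  \<open>K\<close> exhaust almost the whole interval. The exceptional null set is removed inside a
  small open set, which keeps the result closed; each loss is below
  \<open>\<eta> / 2\<close>.\<close>

lemma closed_set_of_bounded_convergence:
  assumes conv: "AE t in lborel. t \<in> {0..2*pi} \<longrightarrow> (\<lambda>N. trig_partial_sum c N t) \<longlonglongrightarrow> 0"
    and \<eta>: "\<eta> > 0"
  obtains G K where "closed G" "G \<subseteq> {0..2*pi}" "measure lborel ({0..2*pi} - G) < \<eta>"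
    "\<And>t L. t \<in> G \<Longrightarrow> norm (trig_partial_sum c L t) \<le> K"
    "\<And>t. t \<in> G \<Longrightarrow> (\<lambda>L. trig_partial_sum c L t) \<longlonglongrightarrow> 0"
proof -
  obtain Z where Z: "Z \<in> null_sets lborel"
      "{t \<in> space lborel. \<not> (t \<in> {0..2*pi} \<longrightarrow> (\<lambda>N. trig_partial_sum c N t) \<longlonglongrightarrow> 0)} \<subseteq> Z"
    using conv unfolding eventually_ae_filter by blast
  define E where "E = (\<lambda>K::nat. {0..2*pi} \<inter> (\<Inter>L. {t. norm (trig_partial_sum c L t) \<le> real K}))"
  have clE: "closed (E K)" for K
    unfolding E_def trig_partial_sum_def
    by (intro closed_Int closed_INT ballI closed_Collect_le continuous_intros)
  define D where "D = (\<lambda>K. {0..2*pi} - E K)"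
  have Dsets: "D K \<in> sets lborel" for K using clE[of K] by (simp add: D_def borel_closed)
  have Dfin: "emeasure lborel A < \<infinity>" if "A \<subseteq> {0..2*pi}" for A :: "real set"
  proof -
    have "emeasure lborel A \<le> emeasure lborel {0..2*pi}"
      by (rule emeasure_mono) (use that in auto)
    also have "\<dots> < \<infinity>" by simp
    finally show ?thesis .
  qed
  have "(\<lambda>K. measure lborel (D K)) \<longlonglongrightarrow> measure lborel (\<Inter>K. D K)"
  proof (rule Lim_measure_decseq)
    show "range D \<subseteq> sets lborel" using Dsets by auto
    have "E m \<subseteq> E n" if "m \<le> n" for m n
    proof -
      have "real m \<le> real n" using that by simp
      then show ?thesis unfolding E_def by (blast intro: order.trans)
    qed
    then show "decseq D" by (auto simp: decseq_def D_def)
    show "emeasure lborel (D K) \<noteq> \<infinity>" for K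
      using Dfin[of "D K"] by (auto simp: D_def)
  qed
  moreover have "measure lborel (\<Inter>K. D K) = 0"
  proof -
    have "(\<Inter>K. D K) \<subseteq> Z"
    proof
      fix t assume t: "t \<in> (\<Inter>K. D K)"
      show "t \<in> Z"
      proof (rule ccontr)
        assume "t \<notin> Z"
        then have "(\<lambda>N. trig_partial_sum c N t) \<longlonglongrightarrow> 0" using t Z(2) by (auto simp: D_def)
        then obtain B where B: "\<And>n. norm (trig_partial_sum c n t) \<le> B"
          using convergent_imp_Bseq[OF convergentI] Bseq_def by metis
        obtain K where "B \<le> real K" using real_arch_simple by blast
        then have "t \<in> E K" using t B by (auto simp: D_def E_def intro: order.trans)
        then show False using t by (auto simp: D_def)
      qed
    qed
    moreover have "(\<Inter>K. D K) \<in> sets lborel" using Dsets by auto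
    ultimately have "(\<Inter>K. D K) \<in> null_sets lborel" using Z(1) null_sets_subset by blast
    then show ?thesis by (simp add: measure_def null_setsD1)
  qed
  ultimately have "(\<lambda>K. measure lborel (D K)) \<longlonglongrightarrow> 0" by simp
  then have "\<forall>\<^sub>F K in sequentially. measure lborel (D K) < \<eta> / 2"
    using \<eta> by (intro order_tendstoD) auto
  then obtain K where K: "measure lborel (D K) < \<eta> / 2"
    using eventually_happens'[OF sequentially_bot] by blast
  have "Z \<in> sets borel" using Z(1) by auto
  then obtain U where U: "open U" "Z \<subseteq> U" "emeasure lborel (U - Z) < \<eta> / 2"
    using outer_regular_lborel[of Z "\<eta> / 2"] \<eta> by auto
  have "emeasure lborel U = emeasure lborel (U - Z)"
    using emeasure_Diff_null_set[OF Z(1), of U] U(1) by (simp add: borel_open)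
  then have U2: "emeasure lborel U < \<eta> / 2" using U(3) by simp
  show thesis
  proof
    show "closed (E K - U)" using clE U(1) by (rule closed_Diff)
    show "E K - U \<subseteq> {0..2*pi}" by (auto simp: E_def)
    show "norm (trig_partial_sum c L t) \<le> real K" if "t \<in> E K - U" for t L
      using that by (auto simp: E_def)
    show "(\<lambda>L. trig_partial_sum c L t) \<longlonglongrightarrow> 0" if "t \<in> E K - U" for t
      using that U(2) Z(2) by (auto simp: E_def)
    have Ufin: "emeasure lborel U < \<infinity>" using U2 by (metis infinity_ennreal_def less_top order_less_trans top_greatest top.not_eq_extremum ennreal_less_top)
    have "measure lborel ({0..2*pi} - (E K - U)) \<le> measure lborel (D K \<union> U)"
    proof (rule measure_mono_fmeasurable)
      show "{0..2*pi} - (E K - U) \<subseteq> D K \<union> U" by (auto simp: D_def)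
      show "{0..2*pi} - (E K - U) \<in> sets lborel" using clE[of K] U(1) by (simp add: borel_closed borel_open sets.Diff)
      show "D K \<union> U \<in> fmeasurable lborel"
        using Dsets Dfin[of "D K"] Ufin U(1) by (intro fmeasurable.Un fmeasurableI) (auto simp: D_def)
    qed
    also have "\<dots> \<le> measure lborel (D K) + measure lborel U"
      using Dsets U(1) by (intro measure_Un_le) (auto simp: borel_open)
    also have "measure lborel U < \<eta> / 2"
      using U2 \<eta> Ufin by (simp add: emeasure_eq_ennreal_measure less_top ennreal_less_iff)
    finally show "measure lborel ({0..2*pi} - (E K - U)) < \<eta>" using K by simp
  qed
qed

section \<open>The barrier argument\<close>

lemma shifted_series_coeff_bound:
  assumes c: "\<And>n. norm (c n) \<le> C" and r: "0 < r" "r < 1"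
    and B: "\<And>\<theta>. \<theta> \<in> {0..2*pi} \<Longrightarrow> norm (shifted_series c N (of_real r * cis \<theta>)) \<le> B"
  shows "norm (c (int j - int N)) * r ^ j \<le> B"
proof -
  define F where "F = Abs_fps (\<lambda>j. c (int j - int N))"
  have ev: "eval_fps F = shifted_series c N"
    by (auto simp: eval_fps_def F_def shifted_series_def)
  have "fps_conv_radius F \<ge> norm (1 / 2 :: complex)"
    unfolding fps_conv_radius_def F_def
    by (rule conv_radius_geI) (use shifted_series_sums(1)[where c = c and z = "1 / 2" and N = N, OF c] in \<open>auto simp: sums_iff\<close>)
  then have "0 < fps_conv_radius F"
    by (rule less_le_trans[rotated]) simp
  then have coeff: "c (int j - int N) = (deriv ^^ j) (shifted_series c N) 0 / fact j"
    using fps_nth_conv_deriv[of F j] ev by (simp add: F_def)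
  have "norm ((deriv ^^ j) (shifted_series c N) 0) \<le> fact j * B / r ^ j"
  proof (rule Cauchy_inequality)
    show "shifted_series c N holomorphic_on ball 0 r"
      by (rule holomorphic_on_subset[OF shifted_series_holomorphic[OF c]]) (use r in auto)
    show "continuous_on (cball 0 r) (shifted_series c N)"
      by (rule continuous_on_subset[OF holomorphic_on_imp_continuous_on[OF shifted_series_holomorphic[OF c]]])
        (use r in auto)
    fix x :: complex assume "norm (0 - x) = r"
    then have "x = of_real r * cis (Arg2pi x)" using Arg2pi_eq[of x] by (simp add: cis_conv_exp)
    moreover have "Arg2pi x \<in> {0..2*pi}" using Arg2pi[of x] by auto
    ultimately show "norm (shifted_series c N x) \<le> B" using B by metis
  qed (use r in auto)
  then show ?thesis using r unfolding coeff by (simp add: norm_divide field_simps)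
qed

text \<open>Keeps the pole-clearing factor \<open>z ^ (4 ^ m)\<close> bounded below on the circle of
  radius \<open>1 - 1 / 4 ^ m\<close>. It follows from \<open>1 - 1 / x \<le> ln x\<close> and
  \<open>1 / (n - 1) \<le> 2 / n\<close>.\<close>

lemma one_minus_inverse_power_ge:
  fixes n :: nat
  assumes "2 \<le> n"
  shows "exp (-2) \<le> (1 - 1 / real n) ^ n"
proof -
  have n: "1 - 1 / real n > 0" "real n - 1 > 0" using assms by auto
  have "ln (1 - 1 / real n) \<ge> - (2 / real n)"
  proof -
    have "1 - inverse (1 - 1 / real n) \<le> ln (1 - 1 / real n)"
      using ln_le_minus_one[of "inverse (1 - 1 / real n)"] n by (simp add: ln_inverse)
    moreover have "1 - inverse (1 - 1 / real n) = - (1 / (real n - 1))"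
      using assms by (simp add: field_simps)
    moreover have "1 / (real n - 1) \<le> 2 / real n"
      using assms by (simp add: field_simps)
    ultimately show ?thesis by linarith
  qed
  then have "real n * ln (1 - 1 / real n) \<ge> real n * (- (2 / real n))"
    by (intro mult_left_mono) auto
  then have "-2 \<le> real n * ln (1 - 1 / real n)" using assms by simp
  then have "exp (-2) \<le> exp (real n * ln (1 - 1 / real n))" by simp
  also have "\<dots> = (1 - 1 / real n) ^ n" using n by (simp add: exp_of_nat_mult)
  finally show ?thesis .
qed

section \<open>The ladder of circles and barriers\<close>

text \<open>The increment 3 of the barrier pays for the factor \<open>exp 2\<close> lost with the
  pole-clearing power and for a factor \<open>2 \<le> exp 1\<close>. The exponent
  \<open>4 * \<alpha> (Suc m)\<close> leaves room to absorb constants, even after a quarter of it is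
  lost in the two-constants estimate.\<close>

locale barrier_ladder =
  fixes c :: "int \<Rightarrow> complex" and C A :: real and \<alpha> :: "nat \<Rightarrow> real" and m0 :: nat
  assumes c_bound: "\<And>n. norm (c n) \<le> C"
    and C_ge: "1 \<le> C" and A_ge: "1 \<le> A"
    and neg_summable: "summable (\<lambda>k. norm (c (- int k)))"
    and m0: "1 \<le> m0"
    and \<alpha>_pos: "\<And>m. m \<ge> m0 \<Longrightarrow> 0 < \<alpha> m"
    and \<alpha>_step: "\<And>m. m \<ge> m0 \<Longrightarrow> \<alpha> m + 3 \<le> \<alpha> (Suc m)"
    and \<alpha>_summable: "summable (\<lambda>m. 1 / \<alpha> m)"
    and tail_bound: "\<And>m. m \<ge> m0 \<Longrightarrow> negative_tail c (4 ^ m) \<le> A * exp (- 4 * \<alpha> (Suc m))"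
begin

definition rad :: "nat \<Rightarrow> real" where "rad m = 1 - 1 / real (4 ^ m)"

definition hs :: "nat \<Rightarrow> complex \<Rightarrow> complex" where "hs m = shifted_series c (4 ^ m)"

text \<open>Since \<open>hs m\<close> is \<open>z ^ (4 ^ m)\<close> times the truncated Laurent
  series \<open>H\<^sub>m\<close>, this is the modulus of \<open>H\<^sub>m\<close> on its
  circle.\<close>

definition modl :: "nat \<Rightarrow> real \<Rightarrow> real" where
  "modl m \<theta> = norm (hs m (of_real (rad m) * cis \<theta>)) / rad m ^ (4 ^ m)"

text \<open>The positive part of \<open>\<alpha> m + ln (modl m \<theta>)\<close>; the maximum
  inside the logarithm makes zeros of \<open>modl\<close> harmless.\<close>

definition excess :: "nat \<Rightarrow> real \<Rightarrow> real" where
  "excess m \<theta> = ln (max 1 (exp (\<alpha> m) * modl m \<theta>))"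

text \<open>The largest value the trivial bound \<open>C / (1 - rad m)\<close> allows for
  \<open>excess m\<close>: \<open>4 ^ m \<le> exp (2 * m)\<close> gives the linear term, and the
  final 2 comes from the pole-clearing factor.\<close>

definition cap :: "nat \<Rightarrow> real" where "cap m = \<alpha> m + (2 * real m + (ln C + 2))"

lemma four_power_ge: "m \<ge> m0 \<Longrightarrow> 4 \<le> (4 ^ m :: nat)"
  using m0 power_increasing[of 1 m "4::nat"] by simp

lemma rad_bounds:
  assumes "m \<ge> m0"
  shows "1 / 2 \<le> rad m" "0 < rad m" "rad m < 1" "exp (- 2) \<le> rad m ^ (4 ^ m)" "rad m ^ (4 ^ m) \<le> 1"
proof -
  have "4 \<le> (4 ^ m :: nat)" using four_power_ge[OF assms] .
  then have "4 \<le> real (4 ^ m)" by (metis of_nat_le_iff of_nat_numeral)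
  then show r: "1 / 2 \<le> rad m" "0 < rad m" "rad m < 1"
    by (auto simp: rad_def field_simps)
  show "exp (- 2) \<le> rad m ^ (4 ^ m)"
    unfolding rad_def using one_minus_inverse_power_ge[of "4 ^ m"] \<open>4 \<le> (4 ^ m :: nat)\<close> by linarith
  show "rad m ^ (4 ^ m) \<le> 1" using r by (intro power_le_one) auto
qed

lemma hs_holomorphic: "hs m holomorphic_on ball 0 1"
  unfolding hs_def by (rule shifted_series_holomorphic[OF c_bound])

lemma \<alpha>_at_top: "filterlim \<alpha> at_top sequentially"
proof -
  have "real k \<le> \<alpha> (k + m0)" for k
  proof (induction k)
    case 0
    then show ?case using \<alpha>_pos[of m0] by simp
  next
    case (Suc k)
    then show ?case using \<alpha>_step[of "k + m0"] by simp
  qed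
  then have "filterlim (\<lambda>k. \<alpha> (k + m0)) at_top sequentially"
    by (intro filterlim_at_top_mono[OF filterlim_real_sequentially] always_eventually allI)
  then show ?thesis
    unfolding filterlim_at_top using eventually_sequentially_seg[of _ m0] by blast
qed

lemma cap_pos: "m \<ge> m0 \<Longrightarrow> \<alpha> m \<le> cap m" "m \<ge> m0 \<Longrightarrow> 0 < cap m"
  using C_ge \<alpha>_pos[of m] by (auto simp: cap_def add_pos_nonneg)

lemma modl_nonneg: "m \<ge> m0 \<Longrightarrow> 0 \<le> modl m \<theta>"
  using rad_bounds[of m] by (simp add: modl_def)

lemma modl_le:
  assumes "m \<ge> m0"
  shows "modl m \<theta> \<le> exp (2 * real m + (ln C + 2))"
proof -
  note r = rad_bounds[OF assms]
  have "norm (hs m (of_real (rad m) * cis \<theta>)) \<le> C / (1 - norm (of_real (rad m) * cis \<theta>))"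
    unfolding hs_def by (rule shifted_series_sums(2)[OF c_bound]) (use r in \<open>simp add: norm_mult\<close>)
  also have "norm (of_real (rad m) * cis \<theta>) = rad m" using r by (simp add: norm_mult)
  also have "C / (1 - rad m) = C * 4 ^ m" by (simp add: rad_def)
  also have "\<dots> \<le> C * exp (2 * real m)"
  proof -
    have "(4::real) \<le> exp 2" using exp_lower_Taylor_quadratic[of "2::real"] by simp
    then have "(4::real) ^ m \<le> exp 2 ^ m" by (intro power_mono) auto
    also have "\<dots> = exp (2 * real m)" by (simp add: exp_of_nat_mult mult.commute)
    finally show ?thesis using C_ge by (intro mult_left_mono) auto
  qed
  finally have "modl m \<theta> \<le> C * exp (2 * real m) / exp (- 2)"
    unfolding modl_def using r C_ge by (intro frac_le) auto
  also have "\<dots> = exp (2 * real m + (ln C + 2))"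
    using C_ge by (simp add: exp_add exp_minus field_simps)
  finally show ?thesis .
qed

lemma excess_bounds:
  assumes "m \<ge> m0"
  shows "0 \<le> excess m \<theta>" "excess m \<theta> \<le> cap m"
proof -
  show "0 \<le> excess m \<theta>" by (simp add: excess_def)
  have "exp (\<alpha> m) * modl m \<theta> \<le> exp (\<alpha> m) * exp (2 * real m + (ln C + 2))"
    by (intro mult_left_mono modl_le assms) auto
  also have "\<dots> = exp (cap m)" by (simp add: cap_def exp_add)
  finally have "max 1 (exp (\<alpha> m) * modl m \<theta>) \<le> exp (cap m)"
    using cap_pos[OF assms] by simp
  then have "ln (max 1 (exp (\<alpha> m) * modl m \<theta>)) \<le> ln (exp (cap m))"
    by (subst ln_le_cancel_iff) auto
  then show "excess m \<theta> \<le> cap m" by (simp add: excess_def)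
qed

lemma continuous_on_hs_circle:
  assumes "0 \<le> r" "r < 1"
  shows "continuous_on T (\<lambda>\<theta>. hs m (of_real r * cis \<theta>))"
  by (rule continuous_on_circle_path[of r])
    (use assms in \<open>auto intro!: continuous_on_subset[OF holomorphic_on_imp_continuous_on[OF hs_holomorphic]]\<close>)

lemma continuous_on_excess:
  assumes "m \<ge> m0"
  shows "continuous_on T (excess m)"
proof -
  have "continuous_on T (\<lambda>\<theta>. max 1 (exp (\<alpha> m) * modl m \<theta>))"
    unfolding modl_def using rad_bounds[OF assms]
    by (intro continuous_intros continuous_on_hs_circle) auto
  moreover have "max 1 x \<noteq> 0" for x :: real by linarith
  ultimately show ?thesis unfolding excess_def by (intro continuous_on_ln) auto
qed

text \<open>The left side is the excess of level \<open>m\<close> carried to the next circle. There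
  \<open>H\<^sub>m\<close> and the next truncation differ by at most the barrier
  \<open>exp (- \<alpha> (Suc m))\<close>, so it is at most the positive part of
  \<open>excess (Suc m) \<theta> - \<delta>\<close>, where \<open>\<delta>\<close> is the barrier
  increment minus 3.\<close>

lemma excess_step_pointwise:
  assumes m: "m \<ge> m0" and big: "exp 2 * A \<le> exp (3 * \<alpha> (Suc m))"
  shows "ln (max 1 (norm (exp (of_real (\<alpha> m)) / of_real (rad m ^ (4 ^ m)) * hs m (of_real (rad (Suc m)) * cis \<theta>))))
    \<le> (\<alpha> m + 3 + (cap (Suc m) - \<alpha> (Suc m))) / cap (Suc m) * excess (Suc m) \<theta>"
proof -
  let ?a = "\<alpha> m" and ?b = "\<alpha> (Suc m)"
  define N where "N = (4::nat) ^ m"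
  define N' where "N' = (4::nat) ^ Suc m"
  define s where "s = rad (Suc m)"
  define z where "z = of_real s * cis \<theta>"
  define \<rho> where "\<rho> = modl (Suc m) \<theta>"
  have m': "Suc m \<ge> m0" using m by simp
  note r = rad_bounds[OF m] and r' = rad_bounds[OF m', folded s_def]
  have NN': "N \<le> N'" by (simp add: N_def N'_def)
  have nz: "norm z = s" using r' by (simp add: z_def norm_mult)
  have \<rho>0: "0 \<le> \<rho>" using modl_nonneg[OF m'] by (simp add: \<rho>_def)
  have \<rho>: "norm (hs (Suc m) z) = \<rho> * s ^ N'"
    using r' by (simp add: \<rho>_def modl_def s_def z_def N'_def)
  have "norm (hs (Suc m) z - z ^ (N' - N) * hs m z) \<le> negative_tail c N"
    unfolding hs_def N_def[symmetric] N'_def[symmetric]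
    by (rule shifted_series_diff_bound[OF c_bound neg_summable NN']) (use nz r' in simp)
  then have "norm (z ^ (N' - N) * hs m z) \<le> \<rho> * s ^ N' + negative_tail c N"
    using \<rho> norm_triangle_ineq3[of "hs (Suc m) z" "z ^ (N' - N) * hs m z"] by linarith
  also have "negative_tail c N \<le> A * exp (- 4 * ?b)" using tail_bound[OF m] by (simp add: N_def)
  also have "A * exp (- 4 * ?b) \<le> exp (- ?b) * s ^ N'"
  proof -
    have "A * exp (- 4 * ?b) = exp (- 2) * (exp 2 * A) * exp (- 4 * ?b)" by (simp add: exp_minus)
    also have "\<dots> \<le> exp (- 2) * exp (3 * ?b) * exp (- 4 * ?b)"
      by (intro mult_right_mono mult_left_mono big) auto
    also have "\<dots> = exp (- 2) * exp (- ?b)" by (simp flip: exp_add)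
    also have "\<dots> \<le> s ^ N' * exp (- ?b)"
      using r'(4) by (intro mult_right_mono) (auto simp: N'_def)
    finally show ?thesis by (simp add: mult.commute)
  qed
  finally have "s ^ (N' - N) * norm (hs m z) \<le> (\<rho> + exp (- ?b)) * s ^ N'"
    by (simp add: norm_mult norm_power nz algebra_simps)
  also have "s ^ N' = s ^ (N' - N) * s ^ N" using NN' by (simp flip: power_add)
  finally have "s ^ (N' - N) * norm (hs m z) \<le> s ^ (N' - N) * ((\<rho> + exp (- ?b)) * s ^ N)"
    by (simp add: mult_ac)
  then have "norm (hs m z) \<le> (\<rho> + exp (- ?b)) * s ^ N"
    using r' by (subst (asm) mult_le_cancel_left_pos) auto
  also have "\<dots> \<le> (\<rho> + exp (- ?b)) * 1"
    using r' \<rho>0 by (intro mult_left_mono power_le_one) auto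
  finally have hm: "norm (hs m z) \<le> \<rho> + exp (- ?b)" by simp
  define y where "y = max 1 (exp ?b * \<rho>)"
  have y: "1 \<le> y" "ln y = excess (Suc m) \<theta>" by (auto simp: y_def excess_def \<rho>_def)
  have "norm (exp (of_real ?a) / of_real (rad m ^ N) * hs m z) = exp ?a / rad m ^ N * norm (hs m z)"
    using r by (simp add: norm_mult norm_divide norm_power)
  also have "\<dots> \<le> exp ?a / exp (- 2) * (\<rho> + exp (- ?b))"
    using r \<rho>0 hm by (intro mult_mono divide_left_mono) (auto simp: N_def)
  also have "\<dots> = exp (?a + 2 - ?b) * (exp ?b * \<rho> + 1)"
    by (simp add: exp_add exp_diff exp_minus field_simps)
  also have "\<dots> \<le> exp (?a + 2 - ?b) * (2 * y)"
  proof (intro mult_left_mono)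
    have "exp ?b * \<rho> \<le> y" by (simp add: y_def)
    then show "exp ?b * \<rho> + 1 \<le> 2 * y" using y(1) by linarith
  qed simp
  \<comment> \<open>The doubling costs one unit in the exponent, 3 together with the 2 from
    \<open>rad m ^ N\<close>.\<close>
  also have "\<dots> \<le> exp (?a + 2 - ?b) * (exp 1 * y)"
    using y exp_ge_add_one_self[of "1::real"] by (intro mult_left_mono mult_right_mono) auto
  also have "\<dots> = exp (?a + 3 - ?b) * y"
    by (simp add: exp_add exp_diff flip: mult.assoc) (simp flip: exp_add)
  finally have up: "norm (exp (of_real ?a) / of_real (rad m ^ N) * hs m z) \<le> exp (?a + 3 - ?b) * y" .
  define \<delta> where "\<delta> = ?b - ?a - 3"
  define x where "x = excess (Suc m) \<theta>"
  have x: "0 \<le> x" "x \<le> cap (Suc m)" using excess_bounds[OF m'] by (auto simp: x_def)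
  have \<delta>: "0 \<le> \<delta>" using \<alpha>_step[OF m] by (simp add: \<delta>_def)
  have cp: "0 < cap (Suc m)" "?b \<le> cap (Suc m)" using cap_pos[OF m'] by auto
  have \<delta>2: "\<delta> \<le> cap (Suc m)" using cp \<alpha>_pos[OF m] by (simp add: \<delta>_def)
  have "ln (max 1 (norm (exp (of_real ?a) / of_real (rad m ^ N) * hs m z))) \<le> ln (max 1 (exp (- \<delta>) * y))"
    using up by (subst ln_le_cancel_iff) (auto simp: \<delta>_def algebra_simps)
  also have "\<dots> \<le> max 0 (x - \<delta>)"
  proof (cases "exp (- \<delta>) * y \<le> 1")
    case False
    then have "ln (max 1 (exp (- \<delta>) * y)) = ln (exp (- \<delta>) * y)" by simp
    also have "\<dots> = x - \<delta>" using y by (subst ln_mult) (auto simp: x_def)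
    finally show ?thesis by simp
  qed simp
  \<comment> \<open>By convexity \<open>max 0 (x - \<delta>)\<close> lies on
    \<open>[0, cap (Suc m)]\<close> below its chord through the origin; equality at the cap is the
    worst case.\<close>
  also have "\<dots> \<le> (cap (Suc m) - \<delta>) / cap (Suc m) * x"
  proof -
    have "x * \<delta> \<le> cap (Suc m) * \<delta>" using x \<delta> by (intro mult_right_mono) auto
    then have "x - \<delta> \<le> (cap (Suc m) - \<delta>) / cap (Suc m) * x"
      using cp by (simp add: field_simps)
    moreover have "0 \<le> (cap (Suc m) - \<delta>) / cap (Suc m) * x" using \<delta>2 cp x by simp
    ultimately show ?thesis by simp
  qed
  also have "cap (Suc m) - \<delta> = \<alpha> m + 3 + (cap (Suc m) - \<alpha> (Suc m))" by (simp add: \<delta>_def)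
  finally show ?thesis by (simp add: x_def z_def s_def N_def)
qed

text \<open>This is \<open>2 * pi\<close> times the mean of \<open>w\<^sub>m\<close>; dividing by
  the cap makes different levels comparable.\<close>

definition total :: "nat \<Rightarrow> real" where
  "total m = integral {0..2*pi} (excess m) / cap m"

lemma excess_integrable: "m \<ge> m0 \<Longrightarrow> excess m integrable_on {0..2*pi}"
  by (intro integrable_continuous_real continuous_on_excess)

lemma total_nonneg: "m \<ge> m0 \<Longrightarrow> 0 \<le> total m"
  unfolding total_def using cap_pos[of m] excess_bounds[of m] excess_integrable[of m]
  by (intro divide_nonneg_pos Henstock_Kurzweil_Integration.integral_nonneg) auto

text \<open>Circle means increase with the radius, and on the outer circle the chord bound applies.
  Its slope has numerator \<open>cap m + 5\<close>: 3 from the pointwise step, 2 because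
  \<open>cap - \<alpha>\<close> grows by 2 per level. Normalisation leaves
  \<open>1 + 5 / cap m\<close>.\<close>

lemma total_step:
  assumes m: "m \<ge> m0" and big: "exp 2 * A \<le> exp (3 * \<alpha> (Suc m))"
  shows "total m \<le> exp (5 * (1 / \<alpha> m)) * total (Suc m)"
proof -
  have m': "Suc m \<ge> m0" using m by simp
  note r = rad_bounds[OF m] and r' = rad_bounds[OF m']
  define f where "f = (\<lambda>z. exp (of_real (\<alpha> m)) / of_real (rad m ^ (4 ^ m)) * hs m z)"
  define q where "q = (\<alpha> m + 3 + (cap (Suc m) - \<alpha> (Suc m))) / cap (Suc m)"
  have fh: "f holomorphic_on ball 0 1"
    unfolding f_def by (intro holomorphic_intros hs_holomorphic) (use r in auto)
  have rr: "rad m \<le> rad (Suc m)" unfolding rad_def by (simp add: frac_le)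
  have fc: "continuous_on (cball 0 (rad (Suc m))) f"
    by (rule continuous_on_subset[OF holomorphic_on_imp_continuous_on[OF fh]]) (use r' in auto)
  have "excess m \<theta> = ln (max 1 (norm (f (of_real (rad m) * cis \<theta>))))" for \<theta>
    using r by (simp add: excess_def modl_def f_def norm_mult norm_divide norm_power)
  then have "integral {0..2*pi} (excess m) = integral {0..2*pi} (\<lambda>\<theta>. ln (max 1 (norm (f (of_real (rad m) * cis \<theta>)))))"
    by presburger
  also have "\<dots> \<le> integral {0..2*pi} (\<lambda>\<theta>. ln (max 1 (norm (f (of_real (rad (Suc m)) * cis \<theta>)))))"
  proof (rule circle_mean_log_plus_mono[of f "ball 0 1" _ "\<lambda>z. ln (max 1 (norm (f z)))"])
    show "continuous_on (cball 0 (rad (Suc m))) (\<lambda>z. ln (max 1 (norm (f z))))"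
      by (intro continuous_intros fc) (auto simp: max_def)
  qed (use fh r r' rr in auto)
  also have "\<dots> \<le> integral {0..2*pi} (\<lambda>\<theta>. q * excess (Suc m) \<theta>)"
  proof (rule integral_le)
    show "(\<lambda>\<theta>. ln (max 1 (norm (f (of_real (rad (Suc m)) * cis \<theta>))))) integrable_on {0..2*pi}"
      using r' by (intro integrable_continuous_real continuous_intros continuous_on_circle_path[OF fc])
        (auto simp: max_def)
    show "(\<lambda>\<theta>. q * excess (Suc m) \<theta>) integrable_on {0..2*pi}"
      by (intro integrable_on_mult_right excess_integrable m')
    show "ln (max 1 (norm (f (of_real (rad (Suc m)) * cis \<theta>)))) \<le> q * excess (Suc m) \<theta>" for \<theta>
      using excess_step_pointwise[OF m big, of \<theta>] by (simp add: f_def q_def)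
  qed
  also have "\<dots> = (\<alpha> m + 3 + (cap (Suc m) - \<alpha> (Suc m))) * total (Suc m)"
    by (simp add: q_def total_def)
  also have "\<alpha> m + 3 + (cap (Suc m) - \<alpha> (Suc m)) = cap m + 5" by (simp add: cap_def)
  finally have "total m \<le> (cap m + 5) * total (Suc m) / cap m"
    unfolding total_def[of m] using cap_pos[OF m] by (intro divide_right_mono) auto
  also have "\<dots> = (1 + 5 / cap m) * total (Suc m)" using cap_pos[OF m] by (simp add: field_simps)
  also have "\<dots> \<le> exp (5 * (1 / \<alpha> m)) * total (Suc m)"
  proof (intro mult_right_mono total_nonneg m')
    have "1 + 5 / cap m \<le> 1 + 5 * (1 / \<alpha> m)"
      using cap_pos[OF m] \<alpha>_pos[OF m] by (simp add: frac_le)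
    also have "\<dots> \<le> exp (5 * (1 / \<alpha> m))" by (rule exp_ge_add_one_self)
    finally show "1 + 5 / cap m \<le> exp (5 * (1 / \<alpha> m))" .
  qed
  finally show ?thesis .
qed

text \<open>Iterating the step multiplies factors \<open>exp (5 / \<alpha> i)\<close>, whose product
  is bounded independently of \<open>M\<close> since the exponents are summable. From
  \<open>m1\<close> on the barrier outweighs the constant \<open>A\<close>.\<close>

lemma total_le_later:
  obtains m1 Q where "m1 \<ge> m0" "0 < Q" "\<And>m M. m1 \<le> m \<Longrightarrow> m \<le> M \<Longrightarrow> total m \<le> Q * total M"
proof -
  have "\<forall>\<^sub>F m in sequentially. \<alpha> m \<ge> ln (exp 2 * A)" using \<alpha>_at_top by (simp add: filterlim_at_top)
  then obtain k where k: "\<And>m. m \<ge> k \<Longrightarrow> \<alpha> m \<ge> ln (exp 2 * A)" unfolding eventually_sequentially by blast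
  define m1 where "m1 = max k m0"
  have big: "exp 2 * A \<le> exp (3 * \<alpha> (Suc m))" if "m \<ge> m1" for m
  proof -
    have "ln (exp 2 * A) \<le> 3 * \<alpha> (Suc m)" using k[of "Suc m"] \<alpha>_pos[of "Suc m"] that by (simp add: m1_def)
    then have "exp (ln (exp 2 * A)) \<le> exp (3 * \<alpha> (Suc m))" by simp
    then show ?thesis using A_ge by simp
  qed
  have chain: "total m \<le> exp (5 * (\<Sum>i=m..<M. 1 / \<alpha> i)) * total M" if "m1 \<le> m" "m \<le> M" for m M
    using that(2)
  proof (induction M rule: dec_induct)
    case (step n)
    have "total n \<le> exp (5 * (1 / \<alpha> n)) * total (Suc n)"
      using step that by (intro total_step big) (auto simp: m1_def)
    then have "exp (5 * (\<Sum>i=m..<n. 1 / \<alpha> i)) * total n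
        \<le> exp (5 * (\<Sum>i=m..<n. 1 / \<alpha> i)) * (exp (5 * (1 / \<alpha> n)) * total (Suc n))"
      by (intro mult_left_mono) auto
    also have "\<dots> = exp (5 * (\<Sum>i=m..<Suc n. 1 / \<alpha> i)) * total (Suc n)"
      using step by (simp add: distrib_left exp_add)
    finally show ?case using step by linarith
  qed simp
  have sm: "summable (\<lambda>i. 1 / \<alpha> (i + m1))" using \<alpha>_summable by (rule summable_ignore_initial_segment)
  define Q where "Q = exp (5 * (\<Sum>i. 1 / \<alpha> (i + m1)))"
  show thesis
  proof
    show "m1 \<ge> m0" "0 < Q" by (auto simp: m1_def Q_def)
    fix m M assume mM: "m1 \<le> m" "m \<le> M"
    have "(\<Sum>i=m..<M. 1 / \<alpha> i) = (\<Sum>i\<in>{m - m1..<M - m1}. 1 / \<alpha> (i + m1))"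
      using mM by (intro sum.reindex_bij_witness[of _ "\<lambda>i. i + m1" "\<lambda>i. i - m1"]) auto
    also have "\<dots> \<le> (\<Sum>i. 1 / \<alpha> (i + m1))"
    proof (intro sum_le_suminf sm)
      fix i
      have "m0 \<le> i + m1" unfolding m1_def by linarith
      then show "0 \<le> 1 / \<alpha> (i + m1)" using \<alpha>_pos[of "i + m1"] by simp
    qed auto
    finally have "exp (5 * (\<Sum>i=m..<M. 1 / \<alpha> i)) \<le> Q" by (simp add: Q_def)
    then have "exp (5 * (\<Sum>i=m..<M. 1 / \<alpha> i)) * total M \<le> Q * total M"
      using mM by (intro mult_right_mono total_nonneg) (auto simp: m1_def)
    with chain[OF mM] show "total m \<le> Q * total M" by linarith
  qed
qed

text \<open>\<open>G\<close> and \<open>S\<close> are fixed before \<open>M\<close>. For large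
  \<open>M\<close> the two-constants estimate makes the excess 0 where
  \<open>Re S \<le> 1 / 4\<close>; elsewhere the excess is at most \<open>cap M\<close>, hence at
  most \<open>4 * cap M * Re S\<close>. Integration leaves the measure of the complement of
  \<open>G\<close>.\<close>

lemma total_eventually_small:
  assumes conv: "AE t in lborel. t \<in> {0..2*pi} \<longrightarrow> (\<lambda>N. trig_partial_sum c N t) \<longlonglongrightarrow> 0"
    and e: "0 < e"
  shows "\<forall>\<^sub>F M in sequentially. total M \<le> e"
proof -
  \<comment> \<open>The factor 32 is 4, from the threshold \<open>1 / 4\<close> for
    \<open>Re S\<close>, times the 8 in the integral of \<open>Re S\<close>.\<close>
  define \<eta> where "\<eta> = e / (32 * pi)"
  have "\<eta> > 0" using e by (simp add: \<eta>_def)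
  then obtain G K where G: "closed G" "G \<subseteq> {0..2*pi}" "measure lborel ({0..2*pi} - G) < \<eta>"
    "\<And>t L. t \<in> G \<Longrightarrow> norm (trig_partial_sum c L t) \<le> K"
    "\<And>t. t \<in> G \<Longrightarrow> (\<lambda>L. trig_partial_sum c L t) \<longlonglongrightarrow> 0"
    using closed_set_of_bounded_convergence[OF conv] by blast
  obtain S where S: "S holomorphic_on ball 0 1"
    "\<And>z. norm z < 1 \<Longrightarrow> 0 \<le> Re (S z)"
    "\<And>r \<theta>. \<lbrakk>0 \<le> r; r < 1; \<theta> \<in> {0..2*pi}; \<And>t. t \<in> G \<Longrightarrow> 1 - r \<le> \<bar>\<theta> - t\<bar>\<rbrakk>
       \<Longrightarrow> 1 \<le> Re (S (of_real r * cis \<theta>))"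
    "\<And>r. 0 < r \<Longrightarrow> r < 1 \<Longrightarrow> integral {0..2*pi} (\<lambda>\<theta>. Re (S (of_real r * cis \<theta>)))
       = 8 * pi * measure lborel ({0..2*pi} - G)"
    using harmonic_measure_complement[of G] G(1) borel_closed by blast
  \<comment> \<open>Dividing \<open>hs M\<close> by \<open>K'\<close> normalises the sawtooth bound
    and the boundary bound with constant \<open>A\<close> at once. \<open>K'\<close> does not depend
    on \<open>M\<close>, so the barrier eventually outgrows it.\<close>
  define K' where "K' = max (2 * (K + negative_tail c 0)) A"
  have K': "1 \<le> K'" "A \<le> K'" "2 * (K + negative_tail c 0) \<le> K'" using A_ge by (auto simp: K'_def)
  \<comment> \<open>If \<open>Re S z < 1\<close>, then some point of \<open>G\<close> is closer than
    \<open>1 - norm z\<close> to the argument of \<open>z\<close>, and the sawtooth bound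
    applies.\<close>
  have hbound: "norm (hs M z) \<le> K'" if z: "norm z < 1" "Re (S z) < 1" for M z
  proof -
    define \<theta> where "\<theta> = Arg2pi z"
    have \<theta>: "\<theta> \<in> {0..2*pi}" using Arg2pi[of z] by (auto simp: \<theta>_def)
    have zeq: "z = of_real (norm z) * cis \<theta>" using Arg2pi_eq[of z] by (simp add: \<theta>_def cis_conv_exp)
    obtain t where t: "t \<in> G" "\<bar>\<theta> - t\<bar> < 1 - norm z"
    proof (rule ccontr)
      assume "\<not> thesis"
      then have "\<And>t. t \<in> G \<Longrightarrow> 1 - norm z \<le> \<bar>\<theta> - t\<bar>" using that by force
      then have "1 \<le> Re (S (of_real (norm z) * cis \<theta>))" using S(3)[of "norm z" \<theta>] \<theta> z by auto
      then show False using z(2) zeq by simp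
    qed
    have "norm (hs M (of_real (norm z) * cis \<theta>)) \<le> 2 * (K + negative_tail c 0)"
      unfolding hs_def
      by (rule shifted_series_sawtooth_bound[OF neg_summable G(4)[OF t(1)]]) (use z t in auto)
    then show ?thesis using K'(3) zeq by simp
  qed
  have "\<forall>\<^sub>F M in sequentially. \<alpha> M \<ge> ln (exp 2 * K')" using \<alpha>_at_top by (simp add: filterlim_at_top)
  moreover have "\<forall>\<^sub>F M in sequentially. M \<ge> m0" by (rule eventually_ge_at_top)
  ultimately show ?thesis
  proof eventually_elim
    case (elim M)
    then have M: "M \<ge> m0" by simp
    let ?b = "\<alpha> (Suc M)"
    have ab: "0 < \<alpha> M" "\<alpha> M \<le> ?b" using \<alpha>_pos[OF M] \<alpha>_step[OF M] by auto
    have big: "exp 2 * K' \<le> exp (2 * ?b)"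
    proof -
      have "ln (exp 2 * K') \<le> 2 * ?b" using elim ab by linarith
      then have "exp (ln (exp 2 * K')) \<le> exp (2 * ?b)" by simp
      then show ?thesis using K' by simp
    qed
    note r = rad_bounds[OF M]
    have ptw: "excess M \<theta> \<le> cap M * (4 * Re (S (of_real (rad M) * cis \<theta>)))" if \<theta>: "\<theta> \<in> {0..2*pi}" for \<theta>
    proof -
      define z where "z = of_real (rad M) * cis \<theta>"
      have nz: "norm z = rad M" using r by (simp add: z_def norm_mult)
      have z: "z \<noteq> 0" "norm z < 1" using nz r by auto
      show ?thesis
      proof (cases "Re (S z) \<le> 1 / 4")
        case False
        then have "cap M * 1 \<le> cap M * (4 * Re (S z))"
          using cap_pos[OF M] by (intro mult_left_mono) auto
        then show ?thesis using excess_bounds(2)[OF M, of \<theta>] by (simp add: z_def)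
      next
        case True
        have "norm (hs M z / of_real K') \<le> exp (- (4 * ?b) * (1 - Re (S z)))"
        proof (rule two_constants_with_boundary_zero_set[OF G(1) _ S(1-3)])
          show "0 \<le> 4 * ?b" using ab by simp
          show "(\<lambda>z. hs M z / of_real K') holomorphic_on ball 0 1"
            by (intro holomorphic_intros hs_holomorphic) (use K' in auto)
          show "norm (hs M z / of_real K') \<le> 1" if "norm z < 1" "Re (S z) < 1" for z
            using hbound[OF that, of M] K' by (simp add: norm_divide)
          show "\<exists>l. ((\<lambda>r. hs M (of_real r * cis t) / of_real K') \<longlongrightarrow> l) (at_left 1) \<and> norm l \<le> exp (- (4 * ?b))"
            if t: "t \<in> G" for t
          proof -
            obtain l where l: "((\<lambda>r. hs M (of_real r * cis t)) \<longlongrightarrow> l) (at_left 1)"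
              "norm l \<le> negative_tail c (4 ^ M)"
              using shifted_series_radial_limit[OF neg_summable G(5)[OF t], of "4 ^ M"] unfolding hs_def by blast
            have "norm l \<le> A * exp (- 4 * ?b)" using l(2) tail_bound[OF M] by simp
            also have "\<dots> \<le> K' * exp (- (4 * ?b))" using K' by simp
            finally have "norm (l / of_real K') \<le> exp (- (4 * ?b))"
              using K' by (simp add: norm_divide divide_le_eq mult.commute)
            then show ?thesis using K' by (intro exI[of _ "l / of_real K'"] conjI tendsto_divide l(1) tendsto_const) auto
          qed
        qed (use z True in auto)
        \<comment> \<open>At least 3/4 of the exponent \<open>4 * ?b\<close> survives. Of the
          remaining \<open>3 * ?b\<close>, a part \<open>2 * ?b\<close> absorbs
          \<open>exp 2 * K'\<close>, and \<open>?b\<close> still exceeds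
          \<open>\<alpha> M\<close>.\<close>
        also have "\<dots> \<le> exp (- (3 * ?b))"
        proof -
          have "3 / 4 * (4 * ?b) \<le> (1 - Re (S z)) * (4 * ?b)" using True ab by (intro mult_right_mono) auto
          then show ?thesis by (simp add: algebra_simps)
        qed
        finally have h1: "norm (hs M z) \<le> K' * exp (- (3 * ?b))"
          using K' by (simp add: norm_divide divide_le_eq mult.commute)
        have "modl M \<theta> \<le> K' * exp (- (3 * ?b)) / exp (- 2)"
          unfolding modl_def z_def[symmetric] using h1 r K' by (intro frac_le) auto
        also have "\<dots> = (exp 2 * K') * exp (- (3 * ?b))" by (simp add: exp_minus field_simps)
        also have "\<dots> \<le> exp (2 * ?b) * exp (- (3 * ?b))" by (intro mult_right_mono big) auto
        also have "\<dots> = exp (- ?b)" by (simp flip: exp_add)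
        also have "\<dots> \<le> exp (- \<alpha> M)" using ab by simp
        finally have "exp (\<alpha> M) * modl M \<theta> \<le> exp (\<alpha> M) * exp (- \<alpha> M)"
          by (intro mult_left_mono) auto
        then have "exp (\<alpha> M) * modl M \<theta> \<le> 1" by (simp flip: exp_add)
        then have "excess M \<theta> = 0" by (simp add: excess_def max_absorb1)
        then show ?thesis using S(2)[OF z(2)] cap_pos[OF M] by (simp add: z_def)
      qed
    qed
    have contS: "continuous_on {0..2*pi} (\<lambda>\<theta>. Re (S (of_real (rad M) * cis \<theta>)))"
      using r by (intro continuous_intros continuous_on_circle_path[of "rad M"]
          continuous_on_subset[OF holomorphic_on_imp_continuous_on[OF S(1)]]) auto
    have "integral {0..2*pi} (excess M) \<le> integral {0..2*pi} (\<lambda>\<theta>. cap M * (4 * Re (S (of_real (rad M) * cis \<theta>))))"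
      by (intro integral_le excess_integrable M ptw integrable_continuous_real continuous_intros contS)
    also have "\<dots> = cap M * (4 * (8 * pi * measure lborel ({0..2*pi} - G)))"
      using S(4)[of "rad M"] r by simp
    also have "\<dots> \<le> cap M * (4 * (8 * pi * \<eta>))"
      using G(3) cap_pos[OF M] by (intro mult_left_mono) auto
    also have "\<dots> = e * cap M" by (simp add: \<eta>_def)
    finally show ?case unfolding total_def using cap_pos[OF M] by (simp add: divide_le_eq)
  qed
qed

text \<open>Later totals tend to 0 and the backward loss is bounded, so \<open>total m = 0\<close>
  and, by continuity, the excess vanishes. Cauchy's inequality then bounds \<open>c n\<close> by a
  fixed multiple of \<open>exp (- \<alpha> m)\<close>, which tends to 0.\<close>

theorem all_coefficients_zero:
  assumes conv: "AE t in lborel. t \<in> {0..2*pi} \<longrightarrow> (\<lambda>N. trig_partial_sum c N t) \<longlonglongrightarrow> 0"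
  shows "c n = 0"
proof -
  obtain m1 Q where Q: "m1 \<ge> m0" "0 < Q" "\<And>m M. m1 \<le> m \<Longrightarrow> m \<le> M \<Longrightarrow> total m \<le> Q * total M"
    using total_le_later by blast
  have below: "modl m \<theta> \<le> exp (- \<alpha> m)" if m: "m \<ge> m1" and \<theta>: "\<theta> \<in> {0..2*pi}" for m \<theta>
  proof -
    have m0': "m \<ge> m0" using m Q by simp
    have "total m \<le> 0"
    proof (rule field_le_epsilon)
      fix e :: real assume "e > 0"
      then have "\<forall>\<^sub>F M in sequentially. total M \<le> e / Q"
        using Q by (intro total_eventually_small conv) auto
      then have "\<forall>\<^sub>F M in sequentially. total M \<le> e / Q \<and> M \<ge> m"
        using eventually_ge_at_top[of m] by eventually_elim simp
      then obtain M where M: "total M \<le> e / Q" "M \<ge> m"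
        using eventually_happens'[OF sequentially_bot] by blast
      have "total m \<le> Q * total M" using Q(3)[OF m M(2)] .
      also have "\<dots> \<le> Q * (e / Q)" using M Q by (intro mult_left_mono) auto
      finally show "total m \<le> 0 + e" using Q by simp
    qed
    then have "integral {0..2*pi} (excess m) = 0"
      using total_nonneg[OF m0'] cap_pos[OF m0'] by (simp add: total_def)
    then have "excess m \<theta> = 0"
      using integral_eq_0_iff[OF continuous_on_excess[OF m0'], of 0 "2*pi"] excess_bounds(1)[OF m0'] \<theta> by auto
    then have "max 1 (exp (\<alpha> m) * modl m \<theta>) = 1"
      unfolding excess_def by (subst (asm) ln_eq_zero_iff) auto
    then have "exp (\<alpha> m) * modl m \<theta> \<le> 1" by simp
    then show ?thesis by (simp add: exp_minus field_simps)
  qed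
  define k where "k = nat \<bar>n\<bar>"
  have cn: "norm (c n) \<le> 2 ^ k * exp (- \<alpha> m)" if m: "m \<ge> m1" and k4: "k \<le> 4 ^ m" for m
  proof -
    have m0': "m \<ge> m0" using m Q by simp
    note r = rad_bounds[OF m0']
    define j where "j = nat (n + int (4 ^ m))"
    have j: "int j - int (4 ^ m) = n" using k4 by (simp add: j_def k_def)
    have "norm (shifted_series c (4 ^ m) (of_real (rad m) * cis \<theta>)) \<le> rad m ^ (4 ^ m) * exp (- \<alpha> m)"
      if "\<theta> \<in> {0..2*pi}" for \<theta>
      using below[OF m that] r by (simp add: modl_def hs_def divide_le_eq mult.commute)
    from shifted_series_coeff_bound[of c, OF c_bound r(2,3) this, of j]
    have le: "norm (c n) * rad m ^ j \<le> rad m ^ (4 ^ m) * exp (- \<alpha> m)" by (simp only: j)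
    \<comment> \<open>Since \<open>j = 4 ^ m + n\<close>, the two powers differ by \<open>k\<close>
      factors \<open>rad m\<close>, each costing at most 2 because
      \<open>rad m \<ge> 1 / 2\<close>.\<close>
    have "rad m ^ (4 ^ m) \<le> rad m ^ j * 2 ^ k"
    proof (cases "n \<ge> 0")
      case True
      then have "j = 4 ^ m + k" using j unfolding k_def by linarith
      then have "rad m ^ j * 2 ^ k = rad m ^ (4 ^ m) * (2 * rad m) ^ k"
        by (simp add: power_add power_mult_distrib mult_ac)
      moreover have "1 \<le> (2 * rad m) ^ k" using r by (intro one_le_power) auto
      then have "rad m ^ (4 ^ m) * 1 \<le> rad m ^ (4 ^ m) * (2 * rad m) ^ k"
        using r by (intro mult_left_mono) auto
      ultimately show ?thesis by linarith
    next
      case False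
      then have "4 ^ m = j + k" using j unfolding k_def by linarith
      then have "rad m ^ (4 ^ m) = rad m ^ j * rad m ^ k" by (simp add: power_add)
      also have "\<dots> \<le> rad m ^ j * 2 ^ k" using r by (intro mult_left_mono power_mono) auto
      finally show ?thesis .
    qed
    then have "rad m ^ (4 ^ m) * exp (- \<alpha> m) \<le> rad m ^ j * 2 ^ k * exp (- \<alpha> m)"
      by (intro mult_right_mono) auto
    with le have "norm (c n) * rad m ^ j \<le> rad m ^ j * 2 ^ k * exp (- \<alpha> m)" by linarith
    then have "rad m ^ j * norm (c n) \<le> rad m ^ j * (2 ^ k * exp (- \<alpha> m))"
      by (simp only: mult.assoc mult.commute[of "norm (c n)"])
    then show ?thesis using r by (subst (asm) mult_le_cancel_left_pos) auto
  qed
  have "(\<lambda>m. 2 ^ k * exp (- \<alpha> m)) \<longlonglongrightarrow> 2 ^ k * 0"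
    by (intro tendsto_mult tendsto_const filterlim_compose[OF exp_at_bot])
      (use \<alpha>_at_top in \<open>simp add: filterlim_uminus_at_bot\<close>)
  moreover have "\<forall>\<^sub>F m in sequentially. norm (c n) \<le> 2 ^ k * exp (- \<alpha> m)"
    using eventually_ge_at_top[of "max m1 k"]
  proof eventually_elim
    case (elim m)
    have "m < 4 ^ m" by (rule less_exp[THEN less_le_trans]) (simp add: power_mono)
    then show ?case using elim by (intro cn) auto
  qed
  ultimately have "norm (c n) \<le> 2 ^ k * 0"
    by (rule tendsto_lowerbound) simp
  then show ?thesis by simp
qed

end

section \<open>Uniqueness\<close>

text \<open>If the ratio stayed below \<open>B\<close> at all positive integers, the summable series
  of \<open>1 / \<omega> n\<close> would dominate a multiple of the harmonic series.\<close>

lemma ratio_unbounded_of_summable_inverse: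
  fixes \<omega> :: "real \<Rightarrow> real"
  assumes pos: "\<forall>t>0. \<omega> t > 0" and incr: "mono_on {0<..} (\<lambda>t. \<omega> t / t)"
    and summ: "summable (\<lambda>n::nat. 1 / \<omega> (real (Suc n)))"
  obtains n0 :: nat where "n0 \<ge> 1" "\<And>t. t \<ge> real n0 \<Longrightarrow> B \<le> \<omega> t / t"
proof -
  have "\<exists>n\<ge>1. B \<le> \<omega> (real n) / real n"
  proof (rule ccontr)
    assume "\<not> (\<exists>n\<ge>1. B \<le> \<omega> (real n) / real n)"
    then have lt: "\<omega> (real (Suc n)) / real (Suc n) < B" for n
      by (metis le_add1 not_le plus_1_eq_Suc)
    have "summable (\<lambda>n. inverse (real (Suc n)))"
    proof (rule summable_comparison_test')
      show "summable (\<lambda>n. B * (1 / \<omega> (real (Suc n))))" by (intro summable_mult summ)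
      fix n
      have p: "0 < \<omega> (real (Suc n))" using pos by simp
      have "\<omega> (real (Suc n)) \<le> B * real (Suc n)" using lt[of n] by (simp add: divide_less_eq)
      then show "norm (inverse (real (Suc n))) \<le> B * (1 / \<omega> (real (Suc n)))"
        using p by (simp add: field_simps)
    qed
    then show False
      using not_summable_harmonic[where 'a = real] summable_Suc_iff[of "\<lambda>n. inverse (real n)"] by simp
  qed
  then obtain n where n: "n \<ge> 1" "B \<le> \<omega> (real n) / real n" by blast
  show thesis
  proof
    show "n \<ge> 1" by fact
    fix t assume t: "real n \<le> t"
    have "\<omega> (real n) / real n \<le> \<omega> t / t"
      using mono_onD[OF incr, of "real n" t] n t by simp
    then show "B \<le> \<omega> t / t" using n(2) by linarith
  qed
qed

text \<open>Besides monotonicity of \<open>\<omega>\<close>, this gives a definite gain on every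
  unit step once the ratio \<open>\<omega> t / t\<close> is large.\<close>

lemma weight_mono:
  fixes \<omega> :: "real \<Rightarrow> real"
  assumes pos: "\<forall>t>0. \<omega> t > 0" and incr: "mono_on {0<..} (\<lambda>t. \<omega> t / t)"
    and s: "0 < s" "s \<le> t"
  shows "\<omega> s + (t - s) * (\<omega> t / t) \<le> \<omega> t"
proof -
  have "s * (\<omega> s / s) \<le> s * (\<omega> t / t)"
    using mono_onD[OF incr, of s t] s by (intro mult_left_mono) auto
  moreover have "(t - s) * (\<omega> t / t) + s * (\<omega> t / t) = \<omega> t"
    using s by (simp add: field_simps)
  ultimately show ?thesis using s by simp
qed

theorem theorem2:
  fixes \<omega> :: "real \<Rightarrow> real" and c :: "int \<Rightarrow> complex"
  assumes pos: "\<forall>t>0. \<omega> t > 0"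
    and incr: "mono_on {0<..} (\<lambda>t. \<omega> t / t)"
    and summ: "summable (\<lambda>n::nat. 1 / \<omega> (real (Suc n)))"
    and conv: "AE t in lborel. t \<in> {0..2*pi} \<longrightarrow> (\<lambda>N. trig_partial_sum c N t) \<longlonglongrightarrow> 0"
    and bigO: "\<exists>C K. \<forall>n::int. n \<le> - K \<longrightarrow> norm (c n) \<le> C * exp (- \<omega> (ln (real_of_int \<bar>n\<bar>)))"
  shows "\<forall>n. c n = 0"
proof -
  obtain C0 K where C0: "\<And>n::int. n \<le> - K \<Longrightarrow> norm (c n) \<le> C0 * exp (- \<omega> (ln (real_of_int \<bar>n\<bar>)))"
    using bigO by blast
  define D where "D = max 1 C0"
  \<comment> \<open>24 is 8 times 3: \<open>\<alpha>\<close> will be an eighth of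
    \<open>\<omega>\<close> and has to gain 3 on every unit step.\<close>
  obtain n0 :: nat where n0: "n0 \<ge> 1" "\<And>t. t \<ge> real n0 \<Longrightarrow> 24 \<le> \<omega> t / t"
    using ratio_unbounded_of_summable_inverse[OF pos incr summ] by metis
  define n1 where "n1 = max n0 (nat K)"
  \<comment> \<open>Half of \<open>\<omega> (ln k)\<close> is kept and is at least
    \<open>\<omega> m / 2\<close> by monotonicity, as \<open>ln k \<ge> m\<close>. The other half is
    at least \<open>2 * ln k\<close> and supplies the summable factor
    \<open>1 / k^2\<close>.\<close>
  have decay: "norm (c (- int k)) \<le> D * exp (- \<omega> (real m) / 2) * (1 / (real k)\<^sup>2)"
    if m: "m \<ge> n1" and k: "4 ^ m \<le> k" for m k
  proof -
    have m1: "1 \<le> m" "n0 \<le> m" "nat K \<le> m" using m n0 by (auto simp: n1_def)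
    have "m < 4 ^ m" by (rule less_exp[THEN less_le_trans]) (simp add: power_mono)
    then have mk: "m < k" using k by simp
    then have k0: "0 < real k" by simp
    have lnk: "real m \<le> ln (real k)"
    proof -
      have "exp (real m) = exp 1 ^ m" by (simp flip: exp_of_nat_mult)
      also have "\<dots> \<le> 4 ^ m" using exp_le by (intro power_mono) auto
      also have "\<dots> \<le> real k" using k by (metis of_nat_le_iff of_nat_numeral of_nat_power)
      finally show ?thesis using k0 by (simp add: ln_ge_iff)
    qed
    define u where "u = ln (real k)"
    have u: "real m \<le> u" "0 < u" using lnk m1 by (auto simp: u_def)
    have pu: "24 \<le> \<omega> u / u" using u m1 by (intro n0) linarith
    have "24 * u \<le> \<omega> u" using pu u by (simp add: le_divide_eq)
    moreover have "\<omega> (real m) \<le> \<omega> u"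
    proof -
      have "0 \<le> (u - real m) * (\<omega> u / u)" using u pu by (intro mult_nonneg_nonneg) auto
      then show ?thesis using weight_mono[OF pos incr, of "real m" u] u m1 by simp
    qed
    ultimately have "- \<omega> u \<le> - \<omega> (real m) / 2 - 2 * u" using u by linarith
    then have "exp (- \<omega> u) \<le> exp (- \<omega> (real m) / 2 - 2 * u)" by simp
    also have "\<dots> = exp (- \<omega> (real m) / 2) * (1 / (exp u)\<^sup>2)"
    proof -
      have "exp (- (2 * u)) = 1 / (exp u)\<^sup>2" by (simp add: exp_minus exp_double divide_inverse)
      moreover have "exp (- \<omega> (real m) / 2 - 2 * u) = exp (- \<omega> (real m) / 2) * exp (- (2 * u))"
        by (simp flip: exp_add)
      ultimately show ?thesis by (simp only:)
    qed
    also have "exp u = real k" using k0 by (simp add: u_def)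
    finally have ex: "exp (- \<omega> u) \<le> exp (- \<omega> (real m) / 2) * (1 / (real k)\<^sup>2)" .
    have "norm (c (- int k)) \<le> C0 * exp (- \<omega> u)"
      using C0[of "- int k"] mk m1 by (simp add: u_def)
    also have "\<dots> \<le> D * exp (- \<omega> u)" by (simp add: D_def)
    also have "\<dots> \<le> D * (exp (- \<omega> (real m) / 2) * (1 / (real k)\<^sup>2))"
      using ex by (intro mult_left_mono) (auto simp: D_def)
    finally show ?thesis by (simp add: mult.assoc)
  qed
  have sq: "summable (\<lambda>k. 1 / (real k)\<^sup>2)"
    using inverse_power_summable[of 2, where 'a = real] by (simp add: divide_inverse)
  have neg: "summable (\<lambda>k. norm (c (- int k)))"
  proof (rule summable_comparison_test')
    show "summable (\<lambda>k. D * exp (- \<omega> (real n1) / 2) * (1 / (real k)\<^sup>2))"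
      by (intro summable_mult sq)
    show "norm (norm (c (- int k))) \<le> D * exp (- \<omega> (real n1) / 2) * (1 / (real k)\<^sup>2)" if "k \<ge> 4 ^ n1" for k
      using decay[OF order.refl that] by simp
  qed
  define A where "A = max 1 (D * (\<Sum>k. 1 / (real k)\<^sup>2))"
  have tail: "negative_tail c (4 ^ m) \<le> A * exp (- \<omega> (real m) / 2)" if m: "m \<ge> n1" for m
  proof -
    define f where "f = (\<lambda>k. D * exp (- \<omega> (real m) / 2) * (1 / (real k)\<^sup>2))"
    have sf: "summable f" unfolding f_def by (intro summable_mult sq)
    have "negative_tail c (4 ^ m) \<le> (\<Sum>k. f (k + (4 ^ m + 1)))"
      unfolding negative_tail_def
    proof (rule suminf_le)
      show "norm (c (- int (k + 4 ^ m + 1))) \<le> f (k + (4 ^ m + 1))" for k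
        using decay[OF m, of "k + 4 ^ m + 1"] by (simp add: f_def add.assoc)
      show "summable (\<lambda>k. norm (c (- int (k + 4 ^ m + 1))))"
        using summable_ignore_initial_segment[OF neg, of "4 ^ m + 1"] by (simp add: add.assoc)
      show "summable (\<lambda>k. f (k + (4 ^ m + 1)))" using sf by (rule summable_ignore_initial_segment)
    qed
    also have "\<dots> \<le> suminf f"
    proof -
      have "0 \<le> (\<Sum>k<4 ^ m + 1. f k)" by (intro sum_nonneg) (simp add: f_def D_def)
      then show ?thesis using suminf_split_initial_segment[OF sf, of "4 ^ m + 1"] by simp
    qed
    also have "\<dots> = D * (\<Sum>k. 1 / (real k)\<^sup>2) * exp (- \<omega> (real m) / 2)"
      unfolding f_def using sq by (subst suminf_mult) auto
    also have "\<dots> \<le> A * exp (- \<omega> (real m) / 2)" by (intro mult_right_mono) (auto simp: A_def)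
    finally show ?thesis .
  qed
  \<comment> \<open>Nonpositive frequencies are bounded by summability. At one point of bounded
    partial sums, consecutive symmetric sums differ by the frequencies \<open>N + 1\<close> and
    \<open>-(N + 1)\<close>, which bounds the positive ones; the threshold \<open>2 * pi\<close>
    makes \<open>G\<close> nonempty.\<close>
  obtain B where B: "\<And>n. norm (c n) \<le> B"
  proof -
    obtain B1 where B1: "\<And>k. norm (c (- int k)) \<le> B1"
      using summable_imp_Bseq[OF neg] by (auto simp: Bseq_def)
    obtain G L where G: "measure lborel ({0..2*pi} - G) < 2 * pi"
      "\<And>t N. t \<in> G \<Longrightarrow> norm (trig_partial_sum c N t) \<le> L"
      using closed_set_of_bounded_convergence[OF conv, of "2 * pi"] by (metis pi_gt_zero zero_less_mult_iff zero_less_numeral)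
    have "G \<noteq> {}" using G(1) by auto
    then obtain t where t: "t \<in> G" by blast
    have "norm (c (int (Suc N))) \<le> 2 * L + B1" for N
    proof -
      let ?u = "\<lambda>n. c n * exp (\<i> * of_int n * of_real t)"
      have "{- int (Suc N)..int (Suc N)} = insert (int (Suc N)) (insert (- int (Suc N)) {- int N..int N})"
        by auto
      then have "trig_partial_sum c (Suc N) t = ?u (int (Suc N)) + (?u (- int (Suc N)) + trig_partial_sum c N t)"
        unfolding trig_partial_sum_def by (simp only:) (subst sum.insert, auto)
      then have "?u (int (Suc N)) = trig_partial_sum c (Suc N) t - trig_partial_sum c N t - ?u (- int (Suc N))"
        by (simp add: algebra_simps)
      then have "norm (?u (int (Suc N))) \<le> norm (trig_partial_sum c (Suc N) t) + norm (trig_partial_sum c N t)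
          + norm (?u (- int (Suc N)))"
        by (metis add_right_mono norm_triangle_ineq4 order_trans)
      then have "norm (c (int (Suc N))) \<le> norm (trig_partial_sum c (Suc N) t)
          + norm (trig_partial_sum c N t) + norm (c (- int (Suc N)))"
        unfolding norm_mult norm_exp_i_int_real by simp
      then show ?thesis using G(2)[OF t, of "Suc N"] G(2)[OF t, of N] B1[of "Suc N"] by linarith
    qed
    then have "norm (c n) \<le> max B1 (2 * L + B1)" for n
    proof (cases "n \<le> 0")
      case True
      then show ?thesis using B1[of "nat (- n)"] by simp
    next
      case False
      then obtain N where "n = int (Suc N)" by (metis not_le zero_less_imp_eq_int Suc_pred)
      then show ?thesis using \<open>\<And>N. norm (c (int (Suc N))) \<le> 2 * L + B1\<close>[of N] by simp
    qed
    then show thesis by (rule that)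
  qed
  \<comment> \<open>The index shift makes the truncation error on level \<open>m\<close>, which is of size \<open>exp (- \<omega> m / 2)\<close>,
    negligible against the barrier on level \<open>m + 1\<close> without any regularity of \<open>\<omega>\<close>.\<close>
  define \<alpha> where "\<alpha> = (\<lambda>m::nat. \<omega> (real (m - 1)) / 8)"
  interpret barrier_ladder c "max 1 B" A \<alpha> "n1 + 2"
  proof
    show "norm (c n) \<le> max 1 B" for n using B[of n] by simp
    show "1 \<le> A" by (simp add: A_def)
    show "0 < \<alpha> m" if "n1 + 2 \<le> m" for m using that pos by (simp add: \<alpha>_def)
    show "\<alpha> m + 3 \<le> \<alpha> (Suc m)" if m: "n1 + 2 \<le> m" for m
    proof -
      have "\<omega> (real (m - 1)) + (real m - real (m - 1)) * (\<omega> (real m) / real m) \<le> \<omega> (real m)"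
        by (rule weight_mono[OF pos incr]) (use m in auto)
      moreover have "real m - real (m - 1) = 1" using m by (simp add: of_nat_diff)
      moreover have "24 \<le> \<omega> (real m) / real m" using m by (intro n0) (simp add: n1_def)
      ultimately show ?thesis by (simp add: \<alpha>_def)
    qed
    \<comment> \<open>Natural subtraction makes both \<open>\<alpha> 0\<close> and
      \<open>\<alpha> 1\<close> equal to \<open>\<omega> 0 / 8\<close>, a value outside the
      hypotheses; the shift by 2 skips them.\<close>
    show "summable (\<lambda>m. 1 / \<alpha> m)"
    proof -
      have "summable (\<lambda>m. 8 * (1 / \<omega> (real (Suc m))))" by (intro summable_mult summ)
      then have "summable (\<lambda>m. 1 / \<alpha> (m + 2))" by (simp add: \<alpha>_def)
      then show ?thesis by (subst (asm) summable_iff_shift)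
    qed
    show "negative_tail c (4 ^ m) \<le> A * exp (- 4 * \<alpha> (Suc m))" if "n1 + 2 \<le> m" for m
      using tail[of m] that by (simp add: \<alpha>_def)
  qed (use neg in auto)
  show ?thesis using all_coefficients_zero[OF conv] by blast
qed

end
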